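(* Let $\nu<\kappa$ be regular uncountable cardinals such that $\operatorname{cf}(\nu,\gamma)<\kappa$ for every ordinal $\gamma$ with $\nu<\gamma<\kappa$. Then for every cardinal $\lambda\ge\kappa^+$, stationary reflection for $\mathcal P_\kappa\lambda$ fails; that is, for every cardinal $\lambda\ge\kappa^+$ there is a stationary set $S\subseteq\mathcal P_\kappa\lambda$ such that $S\cap\mathcal P_\kappa A$ is nonstationary in $\mathcal P_\kappa A$ for every set $A$ with $\kappa\subseteq A\subseteq\lambda$ and $|A|=\kappa$.
   Context: For a set $X$ and a cardinal $\kappa$, $\mathcal P_\kappa X=\{x\subseteq X:|x|<\kappa\}$. For $|X|\ge\kappa$ with $\kappa$ regular uncountable, a set $C\subseteq\mathcal P_\kappa X$ is club if it is cofinal under $\subseteq$ and closed under unions of $\subseteq$-increasing chains of length $<\kappa$; a set is stationary in $\mathcal P_\kappa X$ if it meets every club subset of $\mathcal P_\kappa X$, and nonstationary otherwise. For regular $\nu$ and an ordinal $\gamma\ge\nu$, $\operatorname{cf}(\nu,\gamma)$ denotes the smallest cardinality of a subset $Y\subseteq\mathcal P_\nu\gamma$ that is unbounded, i.e. such that every $x\in\mathcal P_\nu\gamma$ is contained in some $y\in Y$. "Stationary reflection for $\mathcal P_\kappa\lambda$" is the statement: for every stationary $S\subseteq\mathcal P_\kappa\lambda$ there is $A$ with $\kappa\subseteq A\subseteq\lambda$, $|A|=\kappa$, such that $S\cap\mathcal P_\kappa A$ is stationary in $\mathcal P_\kappa A$. *)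

theory Defs
  imports Main
begin

unbundle cardinal_syntax

text \<open>
  Ordinals and cardinals are well-orders, respectively minimal well-orders, on arbitrary
  types; an ordinal \<open>r\<close> is identified with the set \<open>Field r\<close> of its
  elements, and ordinals are compared by \<open><o\<close>, \<open>\<le>o\<close> and \<open>=o\<close>.
\<close>

definition regular_uncountable :: "'k rel \<Rightarrow> bool" where
  "regular_uncountable \<kappa> \<longleftrightarrow> Card_order \<kappa> \<and> natLeq <o \<kappa> \<and> regularCard \<kappa>"

definition P_less :: "'k rel \<Rightarrow> 'a set \<Rightarrow> 'a set set" where
  "P_less \<kappa> X = {x. x \<subseteq> X \<and> |x| <o \<kappa>}"

definition unbounded_in_P :: "'k rel \<Rightarrow> 'a set \<Rightarrow> 'a set set \<Rightarrow> bool" where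
  "unbounded_in_P \<kappa> X Y \<longleftrightarrow>
     Y \<subseteq> P_less \<kappa> X \<and> (\<forall>x \<in> P_less \<kappa> X. \<exists>y \<in> Y. x \<subseteq> y)"

text \<open>
  A chain of length \<open>\<delta> < \<kappa>\<close> is a weakly increasing sequence indexed by
  \<open>underS \<kappa> d\<close>, the set of ordinals below the element \<open>d\<close> of
  \<open>\<kappa>\<close>. The chain of length \<open>0\<close> is excluded: otherwise
  \<open>{}\<close> would belong to every club set.
\<close>

definition club_in_P :: "'k rel \<Rightarrow> 'a set \<Rightarrow> 'a set set \<Rightarrow> bool" where
  "club_in_P \<kappa> X C \<longleftrightarrow>
     unbounded_in_P \<kappa> X C \<and>
     (\<forall>d \<in> Field \<kappa>. \<forall>x :: 'k \<Rightarrow> 'a set.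
        underS \<kappa> d \<noteq> {} \<and> x ` underS \<kappa> d \<subseteq> C \<and> relChain (Restr \<kappa> (underS \<kappa> d)) x
        \<longrightarrow> (\<Union>i \<in> underS \<kappa> d. x i) \<in> C)"

definition stationary_in_P :: "'k rel \<Rightarrow> 'a set \<Rightarrow> 'a set set \<Rightarrow> bool" where
  "stationary_in_P \<kappa> X S \<longleftrightarrow> (\<forall>C. club_in_P \<kappa> X C \<longrightarrow> S \<inter> C \<noteq> {})"

text \<open>\<open>cf_P \<nu> \<gamma>\<close> is the cardinal usually written \<open>cf(\<nu>, \<gamma>)\<close>.\<close>

definition cf_P :: "'n rel \<Rightarrow> 'a rel \<Rightarrow> 'a set rel" where
  "cf_P \<nu> \<gamma> = |SOME Y. unbounded_in_P \<nu> (Field \<gamma>) Y \<and>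
     (\<forall>Z. unbounded_in_P \<nu> (Field \<gamma>) Z \<longrightarrow> |Y| \<le>o |Z| )|"

lemma cf_P_least:
  "\<exists>Y. unbounded_in_P \<nu> (Field \<gamma>) Y \<and> cf_P \<nu> \<gamma> = |Y|" (is ?attained)
  "unbounded_in_P \<nu> (Field \<gamma>) Z \<Longrightarrow> cf_P \<nu> \<gamma> \<le>o |Z|"
proof -
  let ?U = "unbounded_in_P \<nu> (Field \<gamma>)"
  let ?min = "\<lambda>Y. ?U Y \<and> (\<forall>Z. ?U Z \<longrightarrow> |Y| \<le>o |Z| )"
  have "?U (P_less \<nu> (Field \<gamma>))"
    unfolding unbounded_in_P_def by blast
  then have "\<exists>r \<in> card_of ` Collect ?U. \<forall>r' \<in> card_of ` Collect ?U. r \<le>o r'"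
    by (intro exists_minim_Card_order) (auto simp: card_of_Card_order)
  then have "\<exists>Y. ?min Y" by auto
  then have min: "?min (SOME Y. ?min Y)" by (rule someI_ex)
  then show ?attained unfolding cf_P_def by blast
  show "?U Z \<Longrightarrow> cf_P \<nu> \<gamma> \<le>o |Z|"
    using min unfolding cf_P_def by blast
qed

text \<open>
  \<open>ordinals_below \<kappa> lam\<close> is \<open>\<kappa>\<close> as a subset of \<open>lam\<close> (for
  \<open>\<kappa> \<le> lam\<close>): an element \<open>a\<close> of \<open>lam\<close> stands for the
  ordinal \<open>Restr lam (underS lam a)\<close>.
\<close>

definition ordinals_below :: "'k rel \<Rightarrow> 'l rel \<Rightarrow> 'l set" where
  "ordinals_below \<kappa> lam = {a \<in> Field lam. Restr lam (underS lam a) <o \<kappa>}"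

definition stationary_reflection :: "'k rel \<Rightarrow> 'l rel \<Rightarrow> bool" where
  "stationary_reflection \<kappa> lam \<longleftrightarrow>
     (\<forall>S. S \<subseteq> P_less \<kappa> (Field lam) \<and> stationary_in_P \<kappa> (Field lam) S \<longrightarrow>
        (\<exists>A. ordinals_below \<kappa> lam \<subseteq> A \<and> A \<subseteq> Field lam \<and> |A| =o \<kappa> \<and>
             stationary_in_P \<kappa> A (S \<inter> P_less \<kappa> A)))"

end

theory Submission
  imports Defs
begin

text \<open>
  Write \<open>\<kappa>\<^sup>+\<close> for the initial segment of \<open>lam\<close> of that order type, and fix injections of its
  subsets \<open>D\<close> of size at most \<open>\<kappa>\<close> into \<open>\<kappa>\<close>. If \<open>\<kappa> \<subseteq> A\<close> has size \<open>\<kappa>\<close> and is closed under these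
  injections and their inverses, then \<open>D = A \<inter> \<kappa>\<^sup>+\<close> is an ordinal, and club many \<open>x\<close> satisfy
  \<open>x \<inter> \<kappa>\<^sup>+ = D\<^sub>\<xi>\<close>, where \<open>\<xi> = x \<inter> \<kappa>\<close> and \<open>D\<^sub>\<xi>\<close> is the preimage of \<open>\<xi>\<close> under the injection of \<open>D\<close>.
  Either \<open>D\<close> has cofinality below \<open>\<kappa>\<close> and then \<open>sup D\<^sub>\<xi> = D\<close> for large \<open>\<xi>\<close>, or \<open>D\<close> has cofinality
  \<open>\<kappa>\<close> and then \<open>sup D\<^sub>\<xi>\<close> and \<open>\<xi>\<close> have the same cofinality for club many \<open>\<xi>\<close>. So the set of all
  \<open>x\<close> for which \<open>\<xi>\<close> has uncountable cofinality, \<open>\<delta> = sup (x \<inter> \<kappa>\<^sup>+)\<close> has countable cofinality, and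
  \<open>x \<inter> \<kappa>\<^sup>+ \<noteq> \<delta>\<^sub>\<xi>\<close> does not reflect.

  It is stationary by a game of length \<open>\<omega>\<close>: for a given club and \<open>\<xi> < \<kappa>\<close>, the second player tries
  to choose arbitrarily large \<open>b\<^sub>0, b\<^sub>1, \<dots> < \<kappa>\<^sup>+\<close> such that closing \<open>\<xi> \<union> {b\<^sub>0, b\<^sub>1, \<dots>}\<close> adds no
  element of \<open>\<kappa>\<close>. The first player cannot win for every \<open>\<xi>\<close> of uncountable cofinality, since a
  single sequence can dominate \<open>\<kappa>\<close> many strategies while its closure points \<open>\<xi>\<close> form a club. For
  a \<open>\<xi>\<close> where the first player has no winning strategy, \<open>\<kappa>\<close> many plays with distinct \<open>b\<^sub>0\<close> can be
  interleaved so that all the resulting \<open>x\<close> have the same supremum \<open>\<delta>\<close>. They cannot all be equal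
  to \<open>\<delta>\<^sub>\<xi>\<close> below \<open>\<kappa>\<^sup>+\<close>, because \<open>\<delta>\<^sub>\<xi>\<close> has fewer than \<open>\<kappa>\<close> elements.
\<close>

section \<open>Clubs and closure operations\<close>

text \<open>A set-valued \<open>F\<close> on finite sets stands for finitary functions of all
  arities at once; its values may be infinite.\<close>

inductive_set closure_under :: "('a set \<Rightarrow> 'a set) \<Rightarrow> 'a set \<Rightarrow> 'a set" for F Z where
  base: "z \<in> Z \<Longrightarrow> z \<in> closure_under F Z"
| step: "finite s \<Longrightarrow> \<forall>t\<in>s. t \<in> closure_under F Z \<Longrightarrow> y \<in> F s \<Longrightarrow> y \<in> closure_under F Z"

lemma closure_under_mono: "Y \<subseteq> Z \<Longrightarrow> closure_under F Y \<subseteq> closure_under F Z"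
proof
  fix y assume "Y \<subseteq> Z" "y \<in> closure_under F Y"
  from this(2,1) show "y \<in> closure_under F Z"
    by induction (auto intro: closure_under.intros)
qed

text \<open>A derivation branches finitely at each step, so it uses finitely many elements of
  \<open>Z\<close>. Hence closures commute with directed unions.\<close>

lemma closure_under_finite_support:
  assumes "y \<in> closure_under F Z"
  shows "\<exists>Y. finite Y \<and> Y \<subseteq> Z \<and> y \<in> closure_under F Y"
  using assms
proof induction
  case (base z)
  then show ?case by (intro exI[of _ "{z}"]) (auto intro: closure_under.base)
next
  case (step s y)
  then obtain Y where Y: "\<And>t. t \<in> s \<Longrightarrow> finite (Y t) \<and> Y t \<subseteq> Z \<and> t \<in> closure_under F (Y t)"
    by metis
  let ?Y = "\<Union>t\<in>s. Y t"
  have "\<forall>t\<in>s. t \<in> closure_under F ?Y"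
    using Y closure_under_mono[of _ ?Y F] by blast
  then have "y \<in> closure_under F ?Y"
    using step by (blast intro: closure_under.step)
  moreover have "finite ?Y" "?Y \<subseteq> Z" using Y step(1) by auto
  ultimately show ?case by blast
qed

locale regular_uncountable_card =
  fixes \<kappa> :: "'k rel"
  assumes regular_uncountable: "regular_uncountable \<kappa>"
begin

lemma Card_order_kappa: "Card_order \<kappa>"
  and natLeq_less: "natLeq <o \<kappa>"
  and regularCard_kappa: "regularCard \<kappa>"
  using regular_uncountable unfolding regular_uncountable_def by auto

lemma infinite_Field: "infinite (Field \<kappa>)"
  using natLeq_less natLeq_Card_order Card_order_kappa
  by (metis card_of_Field_natLeq card_of_mono2 card_of_ordLeq_finite infinite_UNIV_nat ordLess_imp_ordLeq Field_natLeq)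

lemma Cinfinite_kappa: "Cinfinite \<kappa>"
  using infinite_Field Card_order_kappa unfolding cinfinite_def by blast

lemma small_mono: "A \<subseteq> B \<Longrightarrow> |B| <o \<kappa> \<Longrightarrow> |A| <o \<kappa>"
  using card_of_mono1 ordLeq_ordLess_trans by blast

lemma small_image: "|A| <o \<kappa> \<Longrightarrow> |f ` A| <o \<kappa>"
  using card_of_image ordLeq_ordLess_trans by blast

lemma small_finite: "finite A \<Longrightarrow> |A| <o \<kappa>"
  using Cinfinite_kappa
  by (metis Cfinite_ordLess_Cinfinite Field_card_of card_of_Card_order cfinite_def)

lemma small_nat: "|UNIV :: nat set| <o \<kappa>"
  using natLeq_less card_of_nat ordIso_ordLess_trans by blast

lemma small_UN: "|I| <o \<kappa> \<Longrightarrow> (\<And>i. i \<in> I \<Longrightarrow> |A i| <o \<kappa>) \<Longrightarrow> |\<Union>i\<in>I. A i| <o \<kappa>"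
  using card_of_UNION_ordLess_infinite_Field_regularCard[OF regularCard_kappa Cinfinite_kappa] by blast

lemma small_Un: "|A| <o \<kappa> \<Longrightarrow> |B| <o \<kappa> \<Longrightarrow> |A \<union> B| <o \<kappa>"
  using card_of_Un_ordLess_infinite_Field[OF infinite_Field Card_order_kappa] by blast

lemma small_range_nat: "|range (f :: nat \<Rightarrow> 'a)| <o \<kappa>"
  using small_image[OF small_nat] by blast

lemma small_finite_subsets:
  assumes A: "|A| <o \<kappa>"
  shows "|{s. finite s \<and> s \<subseteq> A}| <o \<kappa>"
proof -
  let ?F = "\<lambda>n. {s. finite s \<and> s \<subseteq> A \<and> card s = n}"
  have F: "|?F n| <o \<kappa>" for n
  proof (induction n)
    case 0
    have "?F 0 \<subseteq> {{}}" by auto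
    then show ?case by (rule small_mono) (simp add: small_finite)
  next
    case (Suc n)
    have "?F (Suc n) \<subseteq> (\<Union>a\<in>A. insert a ` ?F n)"
    proof
      fix s assume s: "s \<in> ?F (Suc n)"
      then obtain a t where "s = insert a t" "a \<notin> t" "card t = n"
        by (auto simp: card_Suc_eq)
      with s show "s \<in> (\<Union>a\<in>A. insert a ` ?F n)" by auto
    qed
    moreover have "|\<Union>a\<in>A. insert a ` ?F n| <o \<kappa>"
      by (intro small_UN A small_image Suc)
    ultimately show ?case by (rule small_mono)
  qed
  have "{s. finite s \<and> s \<subseteq> A} = (\<Union>n\<in>UNIV. ?F n)" by auto
  then show ?thesis using small_UN[OF small_nat, of ?F] F by simp
qed

section \<open>Clubs contain directed unions\<close>

lemma Union_chain_in_club: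
  fixes x :: "'k \<Rightarrow> 'a set"
  assumes "club_in_P \<kappa> X C" "d \<in> Field \<kappa>" "underS \<kappa> d \<noteq> {}"
    "\<And>i. i \<in> underS \<kappa> d \<Longrightarrow> x i \<in> C"
    "\<And>i j. i \<in> underS \<kappa> d \<Longrightarrow> j \<in> underS \<kappa> d \<Longrightarrow> (i, j) \<in> \<kappa> \<Longrightarrow> x i \<subseteq> x j"
  shows "(\<Union>i \<in> underS \<kappa> d. x i) \<in> C"
  using assms unfolding club_in_P_def relChain_def by blast

text \<open>Recursion over finite sets under proper inclusion: \<open>s\<close> and the finitely
  many earlier values form a small set, and \<open>C\<close> is cofinal. Monotonicity makes the
  values over the finite subsets of a set directed.\<close>

lemma ex_monotone_selector:
  assumes C: "club_in_P \<kappa> X C"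
  obtains F where "\<And>s. finite s \<Longrightarrow> s \<subseteq> X \<Longrightarrow> F s \<in> C"
    "\<And>s. finite s \<Longrightarrow> s \<subseteq> X \<Longrightarrow> s \<subseteq> F s"
    "\<And>s t. finite s \<Longrightarrow> s \<subseteq> X \<Longrightarrow> t \<subseteq> s \<Longrightarrow> F t \<subseteq> F s"
proof -
  let ?P = "\<lambda>f s r. finite s \<and> s \<subseteq> X \<longrightarrow> r \<in> C \<and> s \<subseteq> r \<and> (\<forall>t. t \<subset> s \<longrightarrow> f t \<subseteq> r)"
  have "\<exists>f. \<forall>s. ?P f s (f s)"
  proof (rule dependent_wf_choice[OF wf_finite_psubset])
    show "?P f s r = ?P g s r" if "\<And>z. (z, s) \<in> finite_psubset \<Longrightarrow> f z = g z" for f g s r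
      using that unfolding finite_psubset_def by auto
  next
    fix s f assume IH: "\<And>t. (t, s) \<in> finite_psubset \<Longrightarrow> ?P f t (f t)"
    show "\<exists>r. ?P f s r"
    proof (cases "finite s \<and> s \<subseteq> X")
      case True
      let ?u = "s \<union> (\<Union>t\<in>{t. t \<subset> s}. f t)"
      have fin: "finite {t. t \<subset> s}" using True by (auto intro: finite_subset[of _ "Pow s"])
      have f: "f t \<in> P_less \<kappa> X" if "t \<subset> s" for t
      proof -
        have "finite t" using True that finite_subset by blast
        then have "f t \<in> C" using IH[of t] that True unfolding finite_psubset_def by auto
        then show ?thesis using C unfolding club_in_P_def unbounded_in_P_def by blast
      qed
      have "|\<Union>t\<in>{t. t \<subset> s}. f t| <o \<kappa>"
        using f by (intro small_UN small_finite[OF fin]) (simp add: P_less_def)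
      then have "|?u| <o \<kappa>" using True small_Un[OF small_finite[of s]] by blast
      moreover have "?u \<subseteq> X" using f True unfolding P_less_def by blast
      ultimately have "?u \<in> P_less \<kappa> X" unfolding P_less_def by blast
      then obtain r where "r \<in> C" "?u \<subseteq> r"
        using C unfolding club_in_P_def unbounded_in_P_def by blast
      then show ?thesis by (intro exI[of _ r]) auto
    qed auto
  qed
  then obtain f where f: "\<forall>s. ?P f s (f s)" by (elim exE)
  show ?thesis
  proof (rule that[of f])
    fix s assume "finite s" "s \<subseteq> X"
    then show "f s \<in> C" "s \<subseteq> f s" using spec[OF f, of s] by auto
  next
    fix s t assume "finite s" "s \<subseteq> X" "t \<subseteq> s"
    then show "f t \<subseteq> f s" using spec[OF f, of s] by (cases "t = s") auto
  qed
qed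

text \<open>Induction on \<open>|Z|\<close>: an infinite \<open>Z\<close> is listed in order type
  \<open>|Z|\<close>. Its proper initial segments are smaller, and their unions form a chain whose
  union is the one for \<open>Z\<close>.\<close>

lemma directed_Union_in_club:
  fixes Z :: "'a set"
  assumes C: "club_in_P \<kappa> X C"
    and F: "\<And>s. finite s \<Longrightarrow> s \<subseteq> X \<Longrightarrow> F s \<in> C"
    and mono: "\<And>s t. finite s \<Longrightarrow> s \<subseteq> X \<Longrightarrow> t \<subseteq> s \<Longrightarrow> F t \<subseteq> F s"
    and Z: "Z \<subseteq> X" "|Z| <o \<kappa>"
  shows "(\<Union>s\<in>{s. finite s \<and> s \<subseteq> Z}. F s) \<in> C"
proof -
  let ?G = "\<lambda>Z. \<Union>s\<in>{s. finite s \<and> s \<subseteq> Z}. F s"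
  have "\<forall>Z. r = |Z| \<longrightarrow> Z \<subseteq> X \<longrightarrow> |Z| <o \<kappa> \<longrightarrow> ?G Z \<in> C" for r :: "'a rel"
  proof (induction r rule: wf_induct[OF wf_ordLess])
    case (1 r)
    show ?case
    proof (intro allI impI)
      fix Z :: "'a set" assume r: "r = |Z|" and Z: "Z \<subseteq> X" "|Z| <o \<kappa>"
      have IH: "?G Z' \<in> C" if "|Z'| <o |Z|" "Z' \<subseteq> X" for Z' :: "'a set"
        using 1 r that Z ordLess_transitive by blast
      show "?G Z \<in> C"
      proof (cases "finite Z")
        case True
        then have "?G Z = F Z" using mono[of Z] Z by blast
        then show ?thesis using F True Z by simp
      next
        case False
        \<comment> \<open>The segment of \<open>\<kappa>\<close> below \<open>d\<close> copies the
          cardinal \<open>|Z|\<close>, so its own proper initial segments have fewer than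
          \<open>|Z|\<close> elements.\<close>
        obtain d where d: "d \<in> Field \<kappa>" and iso: "|Z| =o Restr \<kappa> (underS \<kappa> d)"
          using Z(2) ordLess_iff_ordIso_Restr[OF _ card_of_Well_order, of \<kappa> Z] Card_order_kappa
          by (auto simp: card_order_on_well_order_on)
        have wo: "Well_order \<kappa>" using Card_order_kappa card_order_on_well_order_on by blast
        let ?r = "Restr \<kappa> (underS \<kappa> d)"
        have Fr: "Field ?r = underS \<kappa> d"
          using wo by (simp add: Field_Restr_ofilter wo_rel.underS_ofilter wo_rel_def)
        have Cr: "Card_order ?r"
          using iso Card_order_ordIso2 card_of_Card_order by blast
        have "|underS \<kappa> d| =o |Z|"
          using card_of_cong[OF iso] Fr by (simp add: Field_card_of ordIso_symmetric)
        then obtain f where f: "bij_betw f (underS \<kappa> d) Z"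
          using card_of_ordIso by blast
        then have fZ: "f ` underS \<kappa> d = Z" by (simp add: bij_betw_def)
        have inf: "infinite (underS \<kappa> d)" using f False bij_betw_finite by blast
        have und: "underS ?r i = underS \<kappa> i" if "i \<in> underS \<kappa> d" for i
          using that wo unfolding underS_def order_on_defs antisym_def trans_def by blast
        have small: "|f ` underS \<kappa> i| <o |Z|" if "i \<in> underS \<kappa> d" for i
        proof -
          have "|underS ?r i| <o ?r" using card_of_underS[OF Cr] that Fr by blast
          then have "|underS \<kappa> i| <o |Z|"
            using und that iso by (metis ordIso_symmetric ordLess_ordIso_trans)
          then show ?thesis using card_of_image ordLeq_ordLess_trans by blast
        qed
        have sub: "f ` underS \<kappa> i \<subseteq> Z" if "i \<in> underS \<kappa> d" for i
          using that wo fZ unfolding underS_def order_on_defs antisym_def trans_def by blast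
        let ?x = "\<lambda>i. ?G (f ` underS \<kappa> i)"
        have "(\<Union>i \<in> underS \<kappa> d. ?x i) \<in> C"
        proof (rule Union_chain_in_club[OF C d])
          show "underS \<kappa> d \<noteq> {}" using inf by auto
          show "?x i \<in> C" if "i \<in> underS \<kappa> d" for i
            by (rule IH) (use small sub that Z in auto)
          show "?x i \<subseteq> ?x j" if "(i, j) \<in> \<kappa>" for i j
          proof -
            have "f ` underS \<kappa> i \<subseteq> f ` underS \<kappa> j"
              using that wo by (intro image_mono underS_incr) (auto simp: order_on_defs)
            then show ?thesis by (intro UN_mono) auto
          qed
        qed
        also have "(\<Union>i \<in> underS \<kappa> d. ?x i) = ?G Z"
        proof
          have "?x i \<subseteq> ?G Z" if "i \<in> underS \<kappa> d" for i
            using sub[OF that] by (intro UN_mono) auto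
          then show "(\<Union>i \<in> underS \<kappa> d. ?x i) \<subseteq> ?G Z" by (rule UN_least)
          have cover: "\<exists>i\<in>underS \<kappa> d. s \<subseteq> f ` underS \<kappa> i" if "finite s" "s \<subseteq> Z" for s
            using that
          proof (induction s)
            case empty
            then show ?case using inf by (metis empty_subsetI ex_in_conv finite.emptyI)
          next
            case (insert z s)
            then obtain i where i: "i \<in> underS \<kappa> d" "s \<subseteq> f ` underS \<kappa> i" by auto
            obtain j where j: "j \<in> underS \<kappa> d" "f j = z" using insert fZ by blast
            have "\<exists>m\<in>underS \<kappa> d. (i, m) \<in> \<kappa> \<and> (j, m) \<in> \<kappa>"
            proof -
              have ij: "i \<in> Field \<kappa>" "j \<in> Field \<kappa>"
                using i(1) j(1) unfolding underS_def Field_def by auto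
              have w: "wo_rel \<kappa>" using wo by (simp add: wo_rel_def)
              show ?thesis
                using wo_rel.TOTALS[OF w] refl_onD[OF wo_rel.REFL[OF w]] ij i(1) j(1) by metis
            qed
            then obtain m where m: "m \<in> underS \<kappa> d" "(i, m) \<in> \<kappa>" "(j, m) \<in> \<kappa>" by blast
            \<comment> \<open>\<open>underS\<close> is strict: to catch \<open>f j\<close> the index
              must exceed \<open>j\<close>. An infinite cardinal order has no last element, so some
              \<open>l\<close> exceeds \<open>m\<close>.\<close>
            obtain l where l: "l \<in> underS \<kappa> d" "(m, l) \<in> \<kappa>" "m \<noteq> l"
              using infinite_Card_order_limit[OF Cr] m(1) inf Fr by auto
            have tr: "trans \<kappa>" and an: "antisym \<kappa>" using wo by (auto simp: order_on_defs)
            have "underS \<kappa> i \<subseteq> underS \<kappa> l"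
              using m(2) l(2) transD[OF tr] by (intro underS_incr tr an) blast
            moreover have "j \<in> underS \<kappa> l"
              using m(3) l(2,3) transD[OF tr] antisymD[OF an] unfolding underS_def by blast
            ultimately have "insert z s \<subseteq> f ` underS \<kappa> l" using i(2) j(2) by blast
            then show ?case using l(1) by blast
          qed
          show "?G Z \<subseteq> (\<Union>i \<in> underS \<kappa> d. ?x i)"
          proof (rule UN_least)
            fix s assume "s \<in> {s. finite s \<and> s \<subseteq> Z}"
            then obtain i where "i \<in> underS \<kappa> d" "finite s" "s \<subseteq> f ` underS \<kappa> i"
              using cover by blast
            then show "F s \<subseteq> (\<Union>i \<in> underS \<kappa> d. ?x i)"
              by (intro subsetI UN_I[of i "underS \<kappa> d"] UN_I[of s]) auto
          qed
        qed
        finally show ?thesis .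
      qed
    qed
  qed
  then show ?thesis using Z by blast
qed

text \<open>The closure is exhausted by \<omega> stages, each small since a small set has fewer than
  \<kappa> finite subsets. The bound on \<open>F\<close> is asked only inside the closure, because a
  selector for a club is controlled only on subsets of the base set.\<close>

lemma small_closure_under:
  assumes Z: "|Z| <o \<kappa>" and F: "\<And>s. finite s \<Longrightarrow> s \<subseteq> closure_under F Z \<Longrightarrow> |F s| <o \<kappa>"
  shows "|closure_under F Z| <o \<kappa>"
proof -
  define g where "g = (\<lambda>Y. Y \<union> (\<Union>s\<in>{s. finite s \<and> s \<subseteq> Y}. F s))"
  define Y where "Y n = (g ^^ n) Z" for n
  have Suc: "Y (Suc n) = Y n \<union> (\<Union>s\<in>{s. finite s \<and> s \<subseteq> Y n}. F s)" for n
    by (simp add: Y_def g_def)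
  have sub: "Y n \<subseteq> closure_under F Z" for n
  proof (induction n)
    case 0
    then show ?case by (auto simp: Y_def intro: closure_under.base)
  next
    case IH: (Suc n)
    then show ?case unfolding Suc by (auto intro: closure_under.step)
  qed
  have small: "|Y n| <o \<kappa>" for n
  proof (induction n)
    case 0
    then show ?case using Z by (simp add: Y_def)
  next
    case IH: (Suc n)
    have "|\<Union>s\<in>{s. finite s \<and> s \<subseteq> Y n}. F s| <o \<kappa>"
      using sub[of n] by (intro small_UN small_finite_subsets IH F) auto
    then show ?case unfolding Suc by (intro small_Un IH)
  qed
  have mono: "Y m \<subseteq> Y n" if "m \<le> n" for m n
    using that by (rule lift_Suc_mono_le[of Y, rotated]) (auto simp: Suc)
  have "closure_under F Z \<subseteq> (\<Union>n\<in>UNIV. Y n)"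
  proof
    fix y assume "y \<in> closure_under F Z"
    then show "y \<in> (\<Union>n\<in>UNIV. Y n)"
    proof induction
      case (base z)
      then have "z \<in> Y 0" by (simp add: Y_def)
      then show ?case by blast
    next
      case (step s y)
      have "\<exists>n. s \<subseteq> Y n" using step.hyps(1) step.IH
      proof (induction s)
        case (insert t s)
        then obtain n m where "s \<subseteq> Y n" "t \<in> Y m" by auto
        then have "insert t s \<subseteq> Y (max n m)"
          using mono[of n "max n m"] mono[of m "max n m"] by auto
        then show ?case by blast
      qed auto
      then obtain n where "s \<subseteq> Y n" by blast
      then have "y \<in> Y (Suc n)" unfolding Suc using step by blast
      then show ?case by blast
    qed
  qed
  moreover have "|\<Union>n\<in>UNIV. Y n| <o \<kappa>" by (intro small_UN small_nat small)
  ultimately show ?thesis by (rule small_mono)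
qed

lemma club_closed_under_set_function:
  assumes p: "p \<subseteq> A" "|p| <o \<kappa>"
    and G: "\<And>a. a \<in> A \<Longrightarrow> G a \<subseteq> A" "\<And>a. a \<in> A \<Longrightarrow> |G a| <o \<kappa>"
  shows "club_in_P \<kappa> A {x. x \<subseteq> A \<and> |x| <o \<kappa> \<and> p \<subseteq> x \<and> (\<forall>a\<in>x. G a \<subseteq> x)}"
    (is "club_in_P \<kappa> A ?C")
proof -
  have "\<exists>y\<in>?C. x \<subseteq> y" if x: "x \<subseteq> A" "|x| <o \<kappa>" for x
  proof -
    let ?F = "\<lambda>s. \<Union>a\<in>s \<inter> A. G a"
    let ?y = "closure_under ?F (p \<union> x)"
    have "?y \<subseteq> A"
    proof
      fix y assume "y \<in> ?y"
      then show "y \<in> A"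
      proof induction
        case (step s y)
        then obtain a where "a \<in> A" "y \<in> G a" by blast
        then show ?case using G(1) by blast
      qed (use p x in blast)
    qed
    moreover have "|?y| <o \<kappa>"
      by (intro small_closure_under small_Un[OF p(2) x(2)] small_UN small_finite[OF finite_Int] G) auto
    moreover have "p \<union> x \<subseteq> ?y" by (auto intro: closure_under.base)
    moreover have "G a \<subseteq> ?y" if "a \<in> ?y" for a
      using that \<open>?y \<subseteq> A\<close> by (auto intro: closure_under.step[of "{a}"])
    ultimately show ?thesis by auto
  qed
  moreover have "(\<Union>i \<in> underS \<kappa> d. x i) \<in> ?C"
    if d: "d \<in> Field \<kappa>" "underS \<kappa> d \<noteq> {}" and x: "x ` underS \<kappa> d \<subseteq> ?C" for d and x :: "'k \<Rightarrow> 'a set"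
  proof -
    have "|underS \<kappa> d| <o \<kappa>" using card_of_underS[OF Card_order_kappa d(1)] .
    then have "|\<Union>i \<in> underS \<kappa> d. x i| <o \<kappa>" using x by (intro small_UN) auto
    moreover have "G a \<subseteq> (\<Union>i \<in> underS \<kappa> d. x i)" if "a \<in> (\<Union>i \<in> underS \<kappa> d. x i)" for a
    proof -
      obtain i where i: "i \<in> underS \<kappa> d" "a \<in> x i" using \<open>a \<in> _\<close> by blast
      then have "G a \<subseteq> x i" using x by blast
      then show ?thesis using i(1) by blast
    qed
    \<comment> \<open>A chain of positive length has a member, and that member contains
      \<open>p\<close>.\<close>
    moreover obtain j where "j \<in> underS \<kappa> d" using d(2) by blast
    then have "p \<subseteq> (\<Union>i \<in> underS \<kappa> d. x i)" using x by blast
    moreover have "(\<Union>i \<in> underS \<kappa> d. x i) \<subseteq> A" using x by blast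
    ultimately show ?thesis by blast
  qed
  ultimately show ?thesis
    unfolding club_in_P_def unbounded_in_P_def P_less_def by auto
qed

end

section \<open>Initial segments of type \<open>\<kappa>\<close> and \<open>\<kappa>\<^sup>+\<close>\<close>

locale below_successor = regular_uncountable_card \<kappa> for \<kappa> :: "'k rel" +
  fixes lam :: "'l rel"
  assumes Card_order_lam: "Card_order lam" and kappa_less_lam: "\<kappa> <o lam"
begin

abbreviation lt :: "'l \<Rightarrow> 'l \<Rightarrow> bool" (infix "\<prec>" 50) where
  "a \<prec> b \<equiv> a \<in> underS lam b"

abbreviation K :: "'l set" where
  "K \<equiv> ordinals_below \<kappa> lam"

text \<open>The initial segment of \<open>lam\<close> of type \<open>\<kappa>\<^sup>+\<close>; it is
  all of \<open>Field lam\<close> if \<open>lam\<close> itself has that type.\<close>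

definition Kp :: "'l set" where
  "Kp = {a \<in> Field lam. |underS lam a| \<le>o \<kappa>}"

lemma Well_order_lam: "Well_order lam"
  using Card_order_lam card_order_on_well_order_on by blast

lemma wo_rel_lam: "wo_rel lam"
  using Well_order_lam by (simp add: wo_rel_def)

lemma trans_lam: "trans lam" and antisym_lam: "antisym lam"
  using wo_rel.TRANS[OF wo_rel_lam] wo_rel.ANTISYM[OF wo_rel_lam] .

lemma lt_trans: "a \<prec> b \<Longrightarrow> b \<prec> c \<Longrightarrow> a \<prec> c"
  using transD[OF trans_lam, of a b c] antisymD[OF antisym_lam, of a b] unfolding underS_def by auto

lemma lt_irrefl: "\<not> a \<prec> a"
  by (simp add: underS_def)

lemma lt_Field: "a \<prec> b \<Longrightarrow> a \<in> Field lam \<and> b \<in> Field lam"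
  by (auto simp: underS_def Field_def)

lemma lt_linear: "a \<in> Field lam \<Longrightarrow> b \<in> Field lam \<Longrightarrow> a \<prec> b \<or> a = b \<or> b \<prec> a"
  using wo_rel.TOTALS[OF wo_rel_lam] by (auto simp: underS_def)

lemma underS_subset: "a \<prec> b \<Longrightarrow> underS lam a \<subseteq> underS lam b"
  using lt_trans by blast

text \<open>\<kappa> is an initial ordinal: a well-order at least as long has at least \<kappa>
  elements.\<close>

lemma Restr_less_iff: "Restr lam (underS lam a) <o \<kappa> \<longleftrightarrow> |underS lam a| <o \<kappa>"
proof
  have F: "Field (Restr lam (underS lam a)) = underS lam a"
    using wo_rel_lam Well_order_lam by (simp add: Field_Restr_ofilter wo_rel.underS_ofilter)
  have W: "Well_order (Restr lam (underS lam a))" using Well_order_Restr[OF Well_order_lam] .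
  then have "|underS lam a| \<le>o Restr lam (underS lam a)" using card_of_least F by metis
  then show "|underS lam a| <o \<kappa>" if "Restr lam (underS lam a) <o \<kappa>"
    using that by (rule ordLeq_ordLess_trans)
  show "Restr lam (underS lam a) <o \<kappa>" if less: "|underS lam a| <o \<kappa>"
  proof (rule ccontr)
    assume "\<not> Restr lam (underS lam a) <o \<kappa>"
    then have "\<kappa> \<le>o Restr lam (underS lam a)"
      using not_ordLess_iff_ordLeq[OF card_order_on_well_order_on[OF Card_order_kappa] W] by simp
    from card_of_mono2[OF this] have "|Field \<kappa>| \<le>o |underS lam a|" using F by simp
    then have "\<kappa> \<le>o |underS lam a|"
      using card_of_Field_ordIso[OF Card_order_kappa] by (meson ordIso_ordLeq_trans ordIso_symmetric)
    with less show False using not_ordLess_ordLeq by blast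
  qed
qed

lemma K_eq: "K = {a \<in> Field lam. |underS lam a| <o \<kappa>}"
  by (simp add: ordinals_below_def Restr_less_iff)

lemma Kp_subset_Field: "Kp \<subseteq> Field lam"
  unfolding Kp_def by blast

lemma K_subset_Field: "K \<subseteq> Field lam"
  unfolding K_eq by blast

lemma K_down: "b \<in> K \<Longrightarrow> a \<prec> b \<Longrightarrow> a \<in> K"
  using lt_Field[of a b] small_mono[OF underS_subset[of a b]] unfolding K_eq by blast

lemma Kp_down: "b \<in> Kp \<Longrightarrow> a \<prec> b \<Longrightarrow> a \<in> Kp"
  using lt_Field[of a b] ordLeq_transitive[OF card_of_mono1[OF underS_subset[of a b]]]
  unfolding Kp_def by blast

text \<open>The least element of \<open>E - D\<close> is the witness.\<close>

lemma downclosed_eq_underS: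
  assumes "D \<subseteq> E" "E \<subseteq> Field lam" "\<not> E \<subseteq> D" "\<And>a b. b \<in> D \<Longrightarrow> a \<prec> b \<Longrightarrow> a \<in> D"
    "\<And>a b. b \<in> E \<Longrightarrow> a \<prec> b \<Longrightarrow> a \<in> E"
  shows "\<exists>a\<in>E. underS lam a = D"
proof -
  have wf: "wf (lam - Id)" using Well_order_lam by (simp add: well_order_on_def)
  obtain a where a: "a \<in> E - D" and min: "\<And>y. (y, a) \<in> lam - Id \<Longrightarrow> y \<notin> E - D"
    using assms(3) wfE_min[OF wf, of _ "E - D"] by blast
  have "underS lam a \<subseteq> D"
  proof
    fix y assume y: "y \<prec> a"
    then have "y \<in> E" using a assms(5) by blast
    moreover have "y \<notin> E - D" using min y by (auto simp: underS_def)
    ultimately show "y \<in> D" by blast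
  qed
  moreover have "D \<subseteq> underS lam a"
  proof
    fix y assume y: "y \<in> D"
    then have "y \<noteq> a" "\<not> a \<prec> y" using a assms(4) by blast+
    then show "y \<prec> a" using lt_linear[of y a] a y assms(1,2) by blast
  qed
  ultimately show ?thesis using a by blast
qed

section \<open>Sizes and regularity of \<open>K\<close> and \<open>Kp\<close>\<close>

lemma not_Field_le: "\<not> |Field lam| \<le>o \<kappa>"
  using kappa_less_lam card_of_Field_ordIso[OF Card_order_lam]
  by (meson not_ordLess_ordLeq ordIso_ordLeq_trans ordIso_symmetric)

text \<open>Otherwise \<open>K\<close> would be the set of predecessors of some \<open>a\<close>,
  and its smallness would put \<open>a\<close> into \<open>K\<close>, below itself.\<close>

lemma not_K_less: "\<not> |K| <o \<kappa>"
proof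
  assume K: "|K| <o \<kappa>"
  then have "\<not> Field lam \<subseteq> K"
    using not_Field_le ordLeq_transitive[OF card_of_mono1[of "Field lam" K] ordLess_imp_ordLeq[OF K]]
    by metis
  then obtain a where "a \<in> Field lam" "underS lam a = K"
    using downclosed_eq_underS[of K "Field lam"] K_down lt_Field K_eq by blast
  then have "a \<in> K" using K by (simp add: K_eq)
  then show False using \<open>underS lam a = K\<close> lt_irrefl by blast
qed

lemma not_Kp_le: "\<not> |Kp| \<le>o \<kappa>"
proof
  assume Kp: "|Kp| \<le>o \<kappa>"
  then have "\<not> Field lam \<subseteq> Kp"
    using not_Field_le card_of_mono1 ordLeq_transitive by blast
  then obtain a where "a \<in> Field lam" "underS lam a = Kp"
    using downclosed_eq_underS[of Kp "Field lam"] Kp_down lt_Field Kp_subset_Field by blast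
  then have "a \<in> Kp" using Kp by (simp add: Kp_def)
  then show False using \<open>underS lam a = Kp\<close> lt_irrefl by blast
qed

text \<open>Order types are compared: if \<open>K\<close> were longer than \<kappa>, some
  \<open>a\<close> in \<open>K\<close> would have predecessors of type \<kappa>.\<close>

lemma K_le: "|K| \<le>o \<kappa>"
proof -
  have of: "wo_rel.ofilter lam K"
    unfolding wo_rel.ofilter_def[OF wo_rel_lam]
  proof (intro conjI ballI subsetI)
    show "a \<in> Field lam" if "a \<in> K" for a using that by (simp add: K_eq)
    show "a \<in> K" if "b \<in> K" "a \<in> under lam b" for a b
      using K_down[OF that(1), of a] that by (cases "a = b") (auto simp: under_def underS_def)
  qed
  then have F: "Field (Restr lam K) = K" using Well_order_lam by (simp add: Field_Restr_ofilter)
  have W: "Well_order (Restr lam K)" using Well_order_Restr[OF Well_order_lam] .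
  have Wk: "Well_order \<kappa>" using Card_order_kappa card_order_on_well_order_on by blast
  have "\<not> \<kappa> <o Restr lam K"
  proof
    assume "\<kappa> <o Restr lam K"
    then obtain a where a: "a \<in> K" and iso: "\<kappa> =o Restr (Restr lam K) (underS (Restr lam K) a)"
      using ordLess_iff_ordIso_Restr[OF W Wk] F by auto
    have "underS (Restr lam K) a = underS lam a"
      using a K_down by (auto simp: underS_def)
    moreover have "Restr (Restr lam K) (underS lam a) = Restr lam (underS lam a)"
      using a K_down by blast
    ultimately have "\<kappa> =o Restr lam (underS lam a)" using iso by simp
    moreover have "Restr lam (underS lam a) <o \<kappa>"
      using a by (simp add: ordinals_below_def)
    ultimately show False using not_ordLess_ordIso ordIso_symmetric by blast
  qed
  then have "Restr lam K \<le>o \<kappa>" using not_ordLess_iff_ordLeq[OF W Wk] by blast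
  moreover have "|K| \<le>o Restr lam K" using card_of_least W F by metis
  ultimately show ?thesis using ordLeq_transitive by blast
qed

text \<open>Regularity of \<kappa>: a small union of small segments cannot cover \<open>K\<close>,
  and any element left out lies above \<open>Z\<close>.\<close>

lemma bounded_in_K:
  assumes "Z \<subseteq> K" "|Z| <o \<kappa>"
  shows "\<exists>k\<in>K. \<forall>z\<in>Z. z \<prec> k"
proof -
  let ?U = "\<Union>z\<in>Z. insert z (underS lam z)"
  have "|insert z (underS lam z)| <o \<kappa>" if "z \<in> Z" for z
    using small_Un[OF small_finite[of "{z}"], of "underS lam z"] that assms(1) by (auto simp: K_eq)
  then have "|?U| <o \<kappa>" using assms(2) by (intro small_UN)
  then have "\<not> K \<subseteq> ?U" using not_K_less small_mono[of K ?U] by metis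
  then obtain k where k: "k \<in> K" "k \<notin> ?U" by blast
  have "z \<prec> k" if "z \<in> Z" for z
    using lt_linear[of z k] k that assms(1) by (auto simp: K_eq)
  then show ?thesis using k by blast
qed

lemma UN_le: "|I| \<le>o \<kappa> \<Longrightarrow> (\<And>i. i \<in> I \<Longrightarrow> |A i| \<le>o \<kappa>) \<Longrightarrow> |\<Union>i\<in>I. A i| \<le>o \<kappa>"
  using card_of_UNION_ordLeq_infinite_Field[OF infinite_Field Card_order_kappa] by blast

lemma bounded_in_Kp:
  assumes "Z \<subseteq> Kp" "|Z| \<le>o \<kappa>"
  shows "\<exists>k\<in>Kp. \<forall>z\<in>Z. z \<prec> k"
proof -
  let ?U = "\<Union>z\<in>Z. insert z (underS lam z)"
  have "|insert z (underS lam z)| \<le>o \<kappa>" if "z \<in> Z" for z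
    using card_of_Un_ordLeq_infinite_Field[OF infinite_Field, of "{z}" "underS lam z"]
      ordLess_imp_ordLeq[OF small_finite[of "{z}"]] Card_order_kappa that assms(1)
    by (auto simp: Kp_def)
  then have "|?U| \<le>o \<kappa>" using assms(2) by (intro UN_le)
  then have "\<not> Kp \<subseteq> ?U" using not_Kp_le card_of_mono1 ordLeq_transitive by blast
  then obtain k where k: "k \<in> Kp" "k \<notin> ?U" by blast
  have "z \<prec> k" if "z \<in> Z" for z
    using lt_linear[of z k] k that assms(1) Kp_subset_Field by blast
  then show ?thesis using k by blast
qed

text \<open>Constant sequences exclude successors. The least element qualifies vacuously, so
  nonemptiness of \<open>underS lam a\<close> is demanded separately where it matters.\<close>

definition uncountable_cofinality :: "'l \<Rightarrow> bool" where
  "uncountable_cofinality a \<longleftrightarrow>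
     (\<forall>c :: nat \<Rightarrow> 'l. range c \<subseteq> underS lam a \<longrightarrow> (\<exists>k\<in>underS lam a. \<forall>n. c n \<prec> k))"

text \<open>A \<nu>-sequence \<open>g\<close> in \<open>K\<close> is built, each term above all
  earlier terms and their images under \<open>f\<close>. Its supremum \<open>a\<close> stays in
  \<open>K\<close> by regularity of \<kappa> and has the uncountable cofinality \<nu>.\<close>

lemma ex_uncountable_cofinality_closed:
  fixes \<nu> :: "'n rel"
  assumes nu: "regular_uncountable \<nu>" "\<nu> <o \<kappa>" and f: "\<And>k. k \<in> K \<Longrightarrow> f k \<in> K"
  shows "\<exists>a\<in>K. uncountable_cofinality a \<and> underS lam a \<noteq> {} \<and>
    (\<forall>k\<in>underS lam a. \<exists>k'\<in>underS lam a. k \<prec> k' \<and> f k' \<prec> a)"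
proof -
  interpret nu: regular_uncountable_card \<nu> by unfold_locales (rule nu)
  have wo: "Well_order \<nu>" using nu.Card_order_kappa card_order_on_well_order_on by blast
  have wf: "wf (\<nu> - Id)" using wo by (simp add: well_order_on_def)
  let ?P = "\<lambda>g i r. i \<in> Field \<nu> \<longrightarrow> r \<in> K \<and> (\<forall>j. (j, i) \<in> \<nu> - Id \<longrightarrow> g j \<prec> r \<and> f (g j) \<prec> r)"
  have "\<exists>g. \<forall>i. ?P g i (g i)"
  proof (rule dependent_wf_choice[OF wf])
    show "?P g i r = ?P h i r" if "\<And>j. (j, i) \<in> \<nu> - Id \<Longrightarrow> g j = h j" for g h i r
      using that by auto
  next
    fix i and g :: "'n \<Rightarrow> 'l" assume IH: "\<And>j. (j, i) \<in> \<nu> - Id \<Longrightarrow> ?P g j (g j)"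
    show "\<exists>r. ?P g i r"
    proof (cases "i \<in> Field \<nu>")
      case True
      let ?Z = "g ` underS \<nu> i \<union> (\<lambda>j. f (g j)) ` underS \<nu> i"
      have "|underS \<nu> i| <o \<kappa>"
        using ordLess_transitive[OF card_of_underS[OF nu.Card_order_kappa True] nu(2)] .
      then have "|?Z| <o \<kappa>" by (intro small_Un small_image)
      moreover have "g j \<in> K" if "j \<in> underS \<nu> i" for j
        using IH[of j] that by (auto simp: underS_def Field_def)
      then have "?Z \<subseteq> K" using f by blast
      ultimately obtain r where "r \<in> K" "\<forall>z\<in>?Z. z \<prec> r" using bounded_in_K[of ?Z] by metis
      then show ?thesis by (intro exI[of _ r]) (auto simp: underS_def)
    qed auto
  qed
  then obtain g where g: "\<forall>i. ?P g i (g i)" by (elim exE)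
  have gK: "g i \<in> K" if "i \<in> Field \<nu>" for i using g that by blast
  have g_less: "g j \<prec> g i" "f (g j) \<prec> g i" if "(j, i) \<in> \<nu>" "j \<noteq> i" for i j
    using that spec[OF g, of i] by (auto simp: Field_def)
  have limit: "\<exists>j\<in>Field \<nu>. i \<noteq> j \<and> (i, j) \<in> \<nu>" if "i \<in> Field \<nu>" for i
    using infinite_Card_order_limit[OF nu.Card_order_kappa nu.infinite_Field] that by blast
  let ?U = "\<Union>i\<in>Field \<nu>. underS lam (g i)"
  have U_down: "a \<in> ?U" if "b \<in> ?U" "a \<prec> b" for a b using that lt_trans by blast
  have "|Field \<nu>| <o \<kappa>"
    using ordIso_ordLess_trans[OF card_of_Field_ordIso[OF nu.Card_order_kappa] nu(2)] .
  then have "|?U| <o \<kappa>" using gK by (intro small_UN) (auto simp: K_eq)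
  then have "\<not> K \<subseteq> ?U" using not_K_less small_mono[of K ?U] by metis
  moreover have "?U \<subseteq> K" using gK K_down by blast
  ultimately have "\<exists>a\<in>K. underS lam a = ?U"
    using K_subset_Field U_down K_down by (intro downclosed_eq_underS)
  then obtain a where a: "a \<in> K" "underS lam a = ?U" by (elim bexE)
  have gU: "g i \<in> ?U" if "i \<in> Field \<nu>" for i
    using limit[OF that] g_less by blast
  have "uncountable_cofinality a" unfolding uncountable_cofinality_def a(2)
  proof (intro allI impI)
    fix c :: "nat \<Rightarrow> 'l" assume "range c \<subseteq> ?U"
    then have "\<forall>n. \<exists>i. i \<in> Field \<nu> \<and> c n \<prec> g i" by blast
    then obtain i where i: "\<And>n. i n \<in> Field \<nu>" "\<And>n. c n \<prec> g (i n)" by metis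
    \<comment> \<open>Regularity of \<nu>: a countable set of indices is bounded.\<close>
    have "\<not> cofinal (range i) \<nu>"
    proof
      assume "cofinal (range i) \<nu>"
      then have "|range i| =o \<nu>"
        using nu.regularCard_kappa i(1) unfolding regularCard_def by blast
      then show False using nu.small_range_nat[of i] not_ordLess_ordIso by blast
    qed
    then obtain m where m: "m \<in> Field \<nu>" "\<And>n. m = i n \<or> (m, i n) \<notin> \<nu>"
      unfolding cofinal_def by blast
    have "(i n, m) \<in> \<nu>" for n
      using m(2)[of n] wo_rel.TOTALS[of \<nu>] wo m(1) i(1)[of n] by (auto simp: wo_rel_def)
    then have "c n \<prec> g m" for n
      using i(2)[of n] g_less(1)[of "i n" m] lt_trans by (cases "i n = m") auto
    then show "\<exists>k\<in>?U. \<forall>n. c n \<prec> k" using gU[OF m(1)] by blast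
  qed
  moreover have "\<exists>k'\<in>underS lam a. k \<prec> k' \<and> f k' \<prec> a" if k: "k \<prec> a" for k
  proof -
    obtain i where i: "i \<in> Field \<nu>" "k \<prec> g i" using k a(2) by blast
    obtain j where "j \<in> Field \<nu>" "i \<noteq> j" "(i, j) \<in> \<nu>" using limit i(1) by blast
    then have "f (g i) \<in> ?U" using g_less(2)[of i j] by blast
    then show ?thesis using i gU[OF i(1)] a(2) by blast
  qed
  moreover have "underS lam a \<noteq> {}"
  proof -
    have "Field \<nu> \<noteq> {}" using nu.infinite_Field by auto
    then show ?thesis using gU a(2) by blast
  qed
  ultimately show ?thesis using a(1) by blast
qed

end

section \<open>A nonreflecting set\<close>

context below_successor
begin

text \<open>The injection is chosen as a function of the set alone, so a set reached in two
  different ways gets the same injection.\<close>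

definition emb :: "'l set \<Rightarrow> 'l \<Rightarrow> 'l" where
  "emb D = (SOME f. inj_on f D \<and> f ` D \<subseteq> K)"

lemma emb:
  assumes "|D| \<le>o \<kappa>"
  shows "inj_on (emb D) D" "emb D ` D \<subseteq> K"
proof -
  have "\<kappa> \<le>o |K|"
    using not_K_less not_ordLess_iff_ordLeq[OF card_order_on_well_order_on[OF Card_order_kappa] card_of_Well_order]
    by metis
  with assms have "|D| \<le>o |K|" by (rule ordLeq_transitive)
  then have "\<exists>f. inj_on f D \<and> f ` D \<subseteq> K" by (simp add: card_of_ordLeq)
  from someI_ex[OF this] show "inj_on (emb D) D" "emb D ` D \<subseteq> K"
    unfolding emb_def by auto
qed

text \<open>The least ordinal above \<open>x \<inter> Kp\<close>, as the set of its
  predecessors.\<close>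

definition down :: "'l set \<Rightarrow> 'l set" where
  "down x = {y \<in> Kp. \<exists>z\<in>x \<inter> Kp. (y, z) \<in> lam}"

text \<open>If \<open>K \<subseteq> A\<close>, this forces \<open>A \<inter> Kp\<close> to be an initial segment of \<open>Kp\<close>.\<close>

definition emb_closed :: "'l set \<Rightarrow> bool" where
  "emb_closed x \<longleftrightarrow> (\<forall>b\<in>x \<inter> Kp. \<forall>y\<in>underS lam b. emb (underS lam b) y \<in> x \<longrightarrow> y \<in> x)"

text \<open>The sequence \<open>c\<close> says that \<open>x \<inter> Kp\<close> has no largest
  element and that its supremum \<delta>, encoded as \<open>down x\<close>, has countable
  cofinality. Here \<open>a\<close> is \<xi>, and the excluded set is
  \<open>\<delta>\<^sub>\<xi>\<close>.\<close>

definition nonreflecting :: "'l set set" where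
  "nonreflecting = {x \<in> P_less \<kappa> (Field lam). emb_closed x \<and>
     (\<exists>c :: nat \<Rightarrow> 'l. range c \<subseteq> x \<inter> Kp \<and> (\<forall>y\<in>x \<inter> Kp. \<exists>n. y \<prec> c n)) \<and>
     (\<exists>a\<in>K. uncountable_cofinality a \<and> x \<inter> K = underS lam a \<and>
        x \<inter> Kp \<noteq> {b \<in> down x. emb (down x) b \<prec> a})}"

lemma nonreflecting_not_stationary:
  assumes A: "K \<subseteq> A" "A \<subseteq> Field lam" "|A| \<le>o \<kappa>"
  shows "\<not> stationary_in_P \<kappa> A (nonreflecting \<inter> P_less \<kappa> A)"
proof
  assume st: "stationary_in_P \<kappa> A (nonreflecting \<inter> P_less \<kappa> A)"
  have ex: "\<exists>x\<in>nonreflecting. x \<subseteq> A \<and> p \<subseteq> x \<and> (\<forall>a\<in>x. G a \<subseteq> x)"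
    if "p \<subseteq> A" "finite p" "\<And>a. a \<in> A \<Longrightarrow> G a \<subseteq> A" "\<And>a. a \<in> A \<Longrightarrow> finite (G a)" for p G
  proof -
    have "club_in_P \<kappa> A {x. x \<subseteq> A \<and> |x| <o \<kappa> \<and> p \<subseteq> x \<and> (\<forall>a\<in>x. G a \<subseteq> x)}"
      using that by (intro club_closed_under_set_function small_finite)
    from st[unfolded stationary_in_P_def, rule_format, OF this] show ?thesis by blast
  qed
  define D where "D = A \<inter> Kp"
  \<comment> \<open>\<open>emb\<close> codes \<open>y\<close> by an element of \<open>K\<close>,
    hence of \<open>A\<close>. Some \<open>x\<close> in the reflected set contains \<open>b\<close>
    and the code, and \<open>emb_closed x\<close> then yields \<open>y\<close>.\<close>
  have D_down: "y \<in> D" if b: "b \<in> D" and y: "y \<prec> b" for b y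
  proof -
    have "|underS lam b| \<le>o \<kappa>" using b by (simp add: D_def Kp_def)
    then have "emb (underS lam b) y \<in> K" using emb(2) y by blast
    then have "{b, emb (underS lam b) y} \<subseteq> A" using A b D_def by blast
    then obtain x where x: "x \<in> nonreflecting" "x \<subseteq> A" "{b, emb (underS lam b) y} \<subseteq> x"
      using ex[of "{b, emb (underS lam b) y}" "\<lambda>_. {}"] by auto
    then have "emb_closed x" by (simp add: nonreflecting_def)
    then have "y \<in> x" using x(3) b y unfolding emb_closed_def D_def by blast
    then show ?thesis using x(2) Kp_down b y D_def by blast
  qed
  have "|D| \<le>o \<kappa>" using ordLeq_transitive[OF card_of_mono1[of D A] A(3)] D_def by blast
  note embD = emb[OF this]
  let ?e = "emb D"
  have key: "\<exists>x\<in>nonreflecting. \<exists>a. x \<inter> K = underS lam a \<and> uncountable_cofinality a \<and> p \<subseteq> x \<and>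
      x \<inter> Kp = {b \<in> D. ?e b \<prec> a} \<and> (\<forall>k\<in>x \<inter> K. h k \<in> x) \<and> x \<inter> Kp \<noteq> {b \<in> down x. emb (down x) b \<prec> a}"
    if p: "p \<subseteq> A" "finite p" and h: "\<And>k. k \<in> K \<Longrightarrow> h k \<in> A" for p h
  proof -
    \<comment> \<open>Closing under \<open>emb D\<close> and its inverse makes
      \<open>x \<inter> Kp\<close> the preimage of \<open>x \<inter> K\<close>; \<open>h\<close>
      stays open for the second case below.\<close>
    define G where "G a = (if a \<in> D then {?e a} else {}) \<union> {b \<in> D. ?e b = a} \<union> (if a \<in> K then {h a} else {})" for a
    have "finite {b \<in> D. ?e b = a}" for a
    proof (rule finite_imageD[of ?e])
      show "finite (?e ` {b \<in> D. ?e b = a})" by (rule finite_subset[of _ "{a}"]) auto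
      show "inj_on ?e {b \<in> D. ?e b = a}" using embD(1) by (rule inj_on_subset) auto
    qed
    then have finG: "finite (G a)" for a by (simp add: G_def)
    have "?e ` D \<subseteq> A" "D \<subseteq> A" using embD(2) A(1) D_def by auto
    then have GA: "G a \<subseteq> A" for a using h by (auto simp: G_def)
    obtain x where x: "x \<in> nonreflecting" "x \<subseteq> A" "p \<subseteq> x" and G: "\<forall>a\<in>x. G a \<subseteq> x"
      using ex[of p G, OF p GA finG] by blast
    obtain a where a: "x \<inter> K = underS lam a" "uncountable_cofinality a"
      "x \<inter> Kp \<noteq> {b \<in> down x. emb (down x) b \<prec> a}"
      using x(1) unfolding nonreflecting_def by blast
    have "x \<inter> Kp = {b \<in> D. ?e b \<prec> a}"
    proof (intro set_eqI iffI)
      fix b assume b: "b \<in> x \<inter> Kp"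
      then have bD: "b \<in> D" using x(2) D_def by blast
      then have "?e b \<in> x" using G b unfolding G_def by auto
      then have "?e b \<in> x \<inter> K" using embD(2) bD by blast
      then show "b \<in> {b \<in> D. ?e b \<prec> a}" using bD a(1) by blast
    next
      fix b assume b: "b \<in> {b \<in> D. ?e b \<prec> a}"
      then have "?e b \<in> x" using a(1) by blast
      then have "G (?e b) \<subseteq> x" using G by blast
      then have "b \<in> x" using b by (auto simp: G_def)
      then show "b \<in> x \<inter> Kp" using b D_def by blast
    qed
    moreover have "\<forall>k\<in>x \<inter> K. h k \<in> x" using G by (auto simp: G_def)
    ultimately show ?thesis using a x by (intro bexI[of _ x] exI[of _ a]) auto
  qed
  have D_Field: "D \<subseteq> Field lam" using D_def Kp_subset_Field by blast
  show False
  \<comment> \<open>The question is whether \<open>D\<close> has cofinality below \<kappa>, that is,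
    whether the preimage of some segment below \<kappa> is cofinal in \<open>D\<close>.\<close>
  proof (cases "\<exists>\<eta>\<in>K. \<forall>y\<in>D. \<exists>b\<in>D. ?e b \<prec> \<eta> \<and> (y, b) \<in> lam")
    case True
    then obtain \<eta> where \<eta>: "\<eta> \<in> K" "\<And>y. y \<in> D \<Longrightarrow> \<exists>b\<in>D. ?e b \<prec> \<eta> \<and> (y, b) \<in> lam" by blast
    obtain x a where x: "x \<inter> K = underS lam a" "{\<eta>} \<subseteq> x" "x \<inter> Kp = {b \<in> D. ?e b \<prec> a}"
      "x \<inter> Kp \<noteq> {b \<in> down x. emb (down x) b \<prec> a}"
      using key[of "{\<eta>}" "\<lambda>k. k"] \<eta>(1) A(1) by blast
    have "\<eta> \<prec> a" using x \<eta>(1) by blast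
    \<comment> \<open>As \<open>a\<close> exceeds \<open>\<eta>\<close>, the set
      \<open>x \<inter> Kp\<close> is cofinal in \<open>D\<close>. Then \<open>down x\<close> and
      \<open>D\<close> share their injection, against the last clause of
      \<open>nonreflecting\<close>.\<close>
    have "down x = D"
    proof (intro set_eqI iffI)
      fix y assume "y \<in> down x"
      then obtain z where "z \<in> D" "(y, z) \<in> lam" unfolding down_def x(3) by blast
      then show "y \<in> D" using D_down[of z y] by (cases "y = z") (auto simp: underS_def)
    next
      fix y assume y: "y \<in> D"
      then obtain b where "b \<in> D" "?e b \<prec> \<eta>" "(y, b) \<in> lam" using \<eta>(2) by blast
      then show "y \<in> down x"
        using y lt_trans[OF _ \<open>\<eta> \<prec> a\<close>] unfolding down_def x(3) D_def by blast
    qed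
    then show False using x(3,4) by simp
  next
    case False
    have "\<exists>y\<in>D. \<forall>b\<in>D. ?e b \<prec> \<eta> \<longrightarrow> b \<prec> y" if \<eta>: "\<eta> \<in> K" for \<eta>
    proof -
      obtain y where y: "y \<in> D" "\<And>b. b \<in> D \<Longrightarrow> ?e b \<prec> \<eta> \<Longrightarrow> (y, b) \<notin> lam"
      proof -
        have "\<not> (\<forall>y\<in>D. \<exists>b\<in>D. ?e b \<prec> \<eta> \<and> (y, b) \<in> lam)"
          using False \<eta> by (metis (lifting))
        then show ?thesis using that by blast
      qed
      have "b \<prec> y" if "b \<in> D" "?e b \<prec> \<eta>" for b
      proof -
        have "(y, b) \<notin> lam" using y that by blast
        then show ?thesis
          using lt_linear[of b y] refl_onD[OF wo_rel.REFL[OF wo_rel_lam], of b] y(1) that(1) D_Field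
          by (auto simp: underS_def)
      qed
      then show ?thesis using y(1) by blast
    qed
    then obtain h where h: "\<And>k. k \<in> K \<Longrightarrow> h k \<in> D" "\<And>k b. k \<in> K \<Longrightarrow> b \<in> D \<Longrightarrow> ?e b \<prec> k \<Longrightarrow> b \<prec> h k"
      by metis
    have hA: "h k \<in> A" if "k \<in> K" for k using h(1)[OF that] by (simp add: D_def)
    obtain x a where x: "x \<in> nonreflecting" "x \<inter> K = underS lam a" "uncountable_cofinality a"
        "x \<inter> Kp = {b \<in> D. ?e b \<prec> a}" "\<And>k. k \<in> x \<inter> K \<Longrightarrow> h k \<in> x"
      using key[of "{}" h] hA by (metis (lifting) empty_subsetI finite.emptyI)
    obtain c :: "nat \<Rightarrow> 'l" where c: "range c \<subseteq> x \<inter> Kp" "\<And>y. y \<in> x \<inter> Kp \<Longrightarrow> \<exists>n. y \<prec> c n"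
    proof -
      have "\<exists>c :: nat \<Rightarrow> 'l. range c \<subseteq> x \<inter> Kp \<and> (\<forall>y\<in>x \<inter> Kp. \<exists>n. y \<prec> c n)"
        using x(1) unfolding nonreflecting_def by (elim CollectE conjE)
      then show ?thesis using that by (metis (lifting))
    qed
    have cD: "c n \<in> D" "?e (c n) \<prec> a" for n using c(1) x(4) by blast+
    \<comment> \<open>Uncountable cofinality bounds the codes of the whole sequence \<open>c\<close>
      by one \<open>k\<close>. Then \<open>h k\<close> lies in \<open>x\<close> above every
      \<open>c n\<close>, so \<open>c\<close> is not cofinal.\<close>
    have "\<exists>k\<in>underS lam a. \<forall>n. ?e (c n) \<prec> k"
      using x(3) cD(2) unfolding uncountable_cofinality_def by (auto dest: spec[of _ "\<lambda>n. ?e (c n)"])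
    then obtain k where k: "k \<prec> a" "\<And>n. ?e (c n) \<prec> k" by blast
    then have kK: "k \<in> x \<inter> K" using x(2) by blast
    then have "h k \<in> x \<inter> Kp" using x(5) h(1) D_def by blast
    then obtain n where "h k \<prec> c n" using c(2) by blast
    moreover have "c n \<prec> h k" using h(2) kK cD(1) k(2) by blast
    ultimately show False using lt_trans lt_irrefl by blast
  qed
qed

end

section \<open>Stationarity\<close>

context below_successor
begin

text \<open>A monotone selector puts the closures of small sets into \<open>C\<close>, and adding
  \<open>E\<close> makes them \<open>emb_closed\<close>. One finitary operation thus replaces the
  club in the game.\<close>

lemma ex_closure_in_club:
  assumes C: "club_in_P \<kappa> (Field lam) C"
  obtains F where "\<And>Z. Z \<subseteq> Field lam \<Longrightarrow> |Z| <o \<kappa> \<Longrightarrow> closure_under F Z \<in> C"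
    "\<And>Z. emb_closed (closure_under F Z)"
proof -
  obtain F where F: "\<And>s. finite s \<Longrightarrow> s \<subseteq> Field lam \<Longrightarrow> F s \<in> C"
    "\<And>s. finite s \<Longrightarrow> s \<subseteq> Field lam \<Longrightarrow> s \<subseteq> F s"
    "\<And>s t. finite s \<Longrightarrow> s \<subseteq> Field lam \<Longrightarrow> t \<subseteq> s \<Longrightarrow> F t \<subseteq> F s"
    using ex_monotone_selector[OF C] by metis
  \<comment> \<open>\<open>E s\<close> is finite for finite \<open>s\<close>, since each
    \<open>emb (underS lam b)\<close> with \<open>b\<close> in \<open>Kp\<close> is injective; so
    closures stay small.\<close>
  define E where "E s = (\<Union>b\<in>s \<inter> Kp. {y \<in> underS lam b. emb (underS lam b) y \<in> s})" for s
  have C_sub: "C \<subseteq> P_less \<kappa> (Field lam)"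
    using C unfolding club_in_P_def unbounded_in_P_def by blast
  have E_Field: "E s \<subseteq> Field lam" for s using lt_Field by (auto simp: E_def)
  have E_fin: "finite (E s)" if "finite s" for s
  proof -
    have "finite {y \<in> underS lam b. emb (underS lam b) y \<in> s}" if b: "b \<in> Kp" for b
    proof (rule finite_imageD[of "emb (underS lam b)"])
      show "finite (emb (underS lam b) ` {y \<in> underS lam b. emb (underS lam b) y \<in> s})"
        using \<open>finite s\<close> by (rule rev_finite_subset) auto
      have "inj_on (emb (underS lam b)) (underS lam b)" using emb(1) b by (simp add: Kp_def)
      then show "inj_on (emb (underS lam b)) {y \<in> underS lam b. emb (underS lam b) y \<in> s}"
        by (rule inj_on_subset) auto
    qed
    then show ?thesis using that by (auto simp: E_def)
  qed
  let ?F = "\<lambda>s. F s \<union> E s"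
  let ?cl = "closure_under ?F"
  have cl_C: "?cl Z \<in> C" if Z: "Z \<subseteq> Field lam" "|Z| <o \<kappa>" for Z
  proof -
    have cl_Field: "?cl Z \<subseteq> Field lam"
    proof
      fix y assume "y \<in> ?cl Z"
      then show "y \<in> Field lam"
      proof induction
        case (step s y)
        then have "s \<subseteq> Field lam" by blast
        then have "F s \<subseteq> Field lam" using F(1) step.hyps(1) C_sub unfolding P_less_def by blast
        then show ?case using step.hyps E_Field[of s] by blast
      qed (use Z in blast)
    qed
    have small: "|?cl Z| <o \<kappa>"
    proof (rule small_closure_under[OF Z(2)])
      fix s assume s: "finite s" "s \<subseteq> ?cl Z"
      then have "F s \<in> C" using F(1) cl_Field by blast
      then have "|F s| <o \<kappa>" using C_sub unfolding P_less_def by blast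
      then show "|F s \<union> E s| <o \<kappa>" by (intro small_Un small_finite[OF E_fin] s)
    qed
    \<comment> \<open>Since \<open>y \<in> F {y}\<close>, the selector's values also cover the
      elements contributed by \<open>E\<close>.\<close>
    have "?cl Z = (\<Union>s\<in>{s. finite s \<and> s \<subseteq> ?cl Z}. F s)"
    proof (intro set_eqI iffI)
      fix y assume y: "y \<in> ?cl Z"
      then have "y \<in> F {y}" using F(2)[of "{y}"] cl_Field by blast
      then show "y \<in> (\<Union>s\<in>{s. finite s \<and> s \<subseteq> ?cl Z}. F s)" using y by (intro UN_I[of "{y}"]) auto
    next
      fix y assume "y \<in> (\<Union>s\<in>{s. finite s \<and> s \<subseteq> ?cl Z}. F s)"
      then obtain s where "finite s" "s \<subseteq> ?cl Z" "y \<in> F s" by blast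
      then show "y \<in> ?cl Z" by (intro closure_under.step[of s]) auto
    qed
    moreover have "(\<Union>s\<in>{s. finite s \<and> s \<subseteq> ?cl Z}. F s) \<in> C"
      by (rule directed_Union_in_club[OF C F(1,3) cl_Field small])
    ultimately show ?thesis by simp
  qed
  moreover have "emb_closed (?cl Z)" for Z unfolding emb_closed_def
  proof (intro ballI impI)
    fix b y assume "b \<in> ?cl Z \<inter> Kp" "y \<prec> b" "emb (underS lam b) y \<in> ?cl Z"
    then show "y \<in> ?cl Z"
      by (intro closure_under.step[of "{b, emb (underS lam b) y}"]) (auto simp: E_def)
  qed
  ultimately show ?thesis using that[of ?F] by metis
qed

text \<open>
  In the game at \<open>a\<close> the first player names lower bounds in \<open>Kp\<close> and the second player
  answers with larger elements \<open>b 0, b 1, \<dots>\<close>; the second player wins if closing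
  \<open>range b \<union> underS lam a\<close> adds no element of \<open>K\<close>. Strategies are those
  of the first player, and \<open>s\<close> is the list of moves already made by the second player.
\<close>

definition winning_strategy :: "('l set \<Rightarrow> 'l set) \<Rightarrow> 'l \<Rightarrow> 'l list \<Rightarrow> ('l list \<Rightarrow> 'l) \<Rightarrow> bool" where
  "winning_strategy F a s \<sigma> \<longleftrightarrow> (\<forall>t. \<sigma> t \<in> Kp) \<and>
     (\<forall>b :: nat \<Rightarrow> 'l. range b \<subseteq> Kp \<and> (\<forall>n<length s. b n = s ! n) \<and>
        (\<forall>n\<ge>length s. \<sigma> (map b [0..<n]) \<prec> b n) \<longrightarrow>
        \<not> closure_under F (range b \<union> underS lam a) \<inter> K \<subseteq> underS lam a)"

definition wins :: "('l set \<Rightarrow> 'l set) \<Rightarrow> 'l \<Rightarrow> 'l list \<Rightarrow> bool" where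
  "wins F a s \<longleftrightarrow> (\<exists>\<sigma>. winning_strategy F a s \<sigma>)"

lemma winning_strategyD:
  assumes "winning_strategy F a s \<sigma>"
  shows "\<sigma> t \<in> Kp"
    "range b \<subseteq> Kp \<Longrightarrow> \<forall>n<length s. b n = s ! n \<Longrightarrow> \<forall>n\<ge>length s. \<sigma> (map b [0..<n]) \<prec> b n \<Longrightarrow>
      \<not> closure_under F (range b \<union> underS lam a) \<inter> K \<subseteq> underS lam a"
  using assms unfolding winning_strategy_def by simp_all

text \<open>If the first player won after every larger \<open>\<beta>\<close>, then playing
  \<open>\<alpha>\<close> and continuing with the strategy for the actual reply would win from
  \<open>s\<close>.\<close>

lemma not_wins_extend:
  assumes nw: "\<not> wins F a s" and \<alpha>: "\<alpha> \<in> Kp"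
  shows "\<exists>\<beta>\<in>Kp. \<alpha> \<prec> \<beta> \<and> \<not> wins F a (s @ [\<beta>])"
proof (rule ccontr)
  assume "\<not> ?thesis"
  then have "\<forall>\<beta>\<in>Kp \<inter> {\<beta>. \<alpha> \<prec> \<beta>}. \<exists>\<tau>. winning_strategy F a (s @ [\<beta>]) \<tau>"
    unfolding wins_def by blast
  then obtain \<tau> where \<tau>: "\<And>\<beta>. \<beta> \<in> Kp \<Longrightarrow> \<alpha> \<prec> \<beta> \<Longrightarrow> winning_strategy F a (s @ [\<beta>]) (\<tau> \<beta>)"
    by (metis IntI mem_Collect_eq)
  let ?l = "length s"
  \<comment> \<open>The reply to \<open>\<alpha>\<close> sits at index \<open>length s\<close>. The
    value \<open>\<alpha>\<close> is the move at \<open>s\<close> itself and also the default at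
    illegal histories, keeping \<open>\<sigma>\<close> inside \<open>Kp\<close>.\<close>
  define \<sigma> where "\<sigma> t = (if ?l < length t \<and> t ! ?l \<in> Kp \<and> \<alpha> \<prec> t ! ?l then \<tau> (t ! ?l) t else \<alpha>)" for t
  have "winning_strategy F a s \<sigma>" unfolding winning_strategy_def
  proof (intro conjI allI impI)
    show "\<sigma> t \<in> Kp" for t using \<alpha> winning_strategyD(1)[OF \<tau>] by (simp add: \<sigma>_def)
    fix b :: "nat \<Rightarrow> 'l"
    assume b: "range b \<subseteq> Kp \<and> (\<forall>n<?l. b n = s ! n) \<and> (\<forall>n\<ge>?l. \<sigma> (map b [0..<n]) \<prec> b n)"
    have bl: "b ?l \<in> Kp" using b by blast
    have "\<sigma> (map b [0..<?l]) \<prec> b ?l" using b by blast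
    then have \<alpha>b: "\<alpha> \<prec> b ?l" by (simp add: \<sigma>_def)
    show "\<not> closure_under F (range b \<union> underS lam a) \<inter> K \<subseteq> underS lam a"
    proof (rule winning_strategyD(2)[OF \<tau>[OF bl \<alpha>b]])
      show "range b \<subseteq> Kp" using b by blast
      show "\<forall>n<length (s @ [b ?l]). b n = (s @ [b ?l]) ! n" using b by (auto simp: less_Suc_eq nth_append)
      show "\<forall>n\<ge>length (s @ [b ?l]). \<tau> (b ?l) (map b [0..<n]) \<prec> b n"
      proof (intro allI impI)
        fix n assume "length (s @ [b ?l]) \<le> n"
        then have n: "Suc ?l \<le> n" by simp
        then have "\<sigma> (map b [0..<n]) \<prec> b n" using b by simp
        moreover have "\<sigma> (map b [0..<n]) = \<tau> (b ?l) (map b [0..<n])"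
          using n bl \<alpha>b by (simp add: \<sigma>_def)
        ultimately show "\<tau> (b ?l) (map b [0..<n]) \<prec> b n" by simp
      qed
    qed
  qed
  with nw show False unfolding wins_def by blast
qed

text \<open>Some play extending \<open>s\<close> defeats a constant strategy, and closures are
  monotone.\<close>

lemma not_wins_closure:
  assumes "\<not> wins F a s"
  shows "closure_under F (set s \<union> underS lam a) \<inter> K \<subseteq> underS lam a"
proof -
  have "Kp \<noteq> {}" using not_Kp_le ordLess_imp_ordLeq[OF small_finite[of "{} :: 'l set"]] by auto
  then obtain \<alpha> where "\<alpha> \<in> Kp" by blast
  moreover have "\<not> winning_strategy F a s (\<lambda>_. \<alpha>)" using assms unfolding wins_def by blast
  ultimately obtain b :: "nat \<Rightarrow> 'l" where b: "\<forall>n<length s. b n = s ! n"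
    and cl: "closure_under F (range b \<union> underS lam a) \<inter> K \<subseteq> underS lam a"
    unfolding winning_strategy_def by (metis (lifting))
  have "set s \<subseteq> range b" using b by (metis in_set_conv_nth rangeI subsetI)
  then have "closure_under F (set s \<union> underS lam a) \<subseteq> closure_under F (range b \<union> underS lam a)"
    by (intro closure_under_mono) blast
  then show ?thesis using cl by blast
qed

text \<open>Otherwise one sequence \<open>b\<close> is a legal play against winning strategies at
  all such \<open>a\<close> at once. The map \<open>f\<close>, bounding what the closure of
  \<open>b\<close> and \<open>k\<close> contains of \<open>K\<close>, has a closure point of
  uncountable cofinality, and there \<open>b\<close> defeats the strategy.\<close>

lemma ex_not_wins:
  fixes \<nu> :: "'n rel"
  assumes nu: "regular_uncountable \<nu>" "\<nu> <o \<kappa>"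
    and F: "\<And>Z. Z \<subseteq> Field lam \<Longrightarrow> |Z| <o \<kappa> \<Longrightarrow> |closure_under F Z| <o \<kappa>"
  shows "\<exists>a\<in>K. uncountable_cofinality a \<and> \<not> wins F a []"
proof (rule ccontr)
  assume contra: "\<not> ?thesis"
  let ?E = "K \<inter> Collect uncountable_cofinality"
  have "\<forall>a\<in>?E. \<exists>\<sigma>. winning_strategy F a [] \<sigma>"
    using contra unfolding wins_def by blast
  then obtain \<sigma> where \<sigma>: "\<And>a. a \<in> ?E \<Longrightarrow> winning_strategy F a [] (\<sigma> a)" by metis
  have "\<exists>\<beta>. \<beta> \<in> Kp \<and> (\<forall>a\<in>?E. \<sigma> a t \<prec> \<beta>)" for t
  proof -
    let ?Z = "(\<lambda>a. \<sigma> a t) ` ?E"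
    have "|?Z| \<le>o |K|" using ordLeq_transitive[OF card_of_image card_of_mono1[of ?E K]] by blast
    then have "|?Z| \<le>o \<kappa>" using K_le by (rule ordLeq_transitive)
    moreover have "?Z \<subseteq> Kp" using winning_strategyD(1)[OF \<sigma>] by blast
    ultimately show ?thesis using bounded_in_Kp[of ?Z] by auto
  qed
  then obtain u where u: "\<And>t. u t \<in> Kp" "\<And>t a. a \<in> ?E \<Longrightarrow> \<sigma> a t \<prec> u t" by metis
  \<comment> \<open>\<open>L n\<close> is the history of the first \<open>n\<close> moves; the move
    \<open>u\<close> after it exceeds what all the strategies demand at that history.\<close>
  define L where "L n = rec_nat [] (\<lambda>_ l. l @ [u l]) n" for n
  define b where "b n = u (L n)" for n
  have L: "L n = map b [0..<n]" for n
    by (induction n) (simp_all add: L_def b_def)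
  have b: "range b \<subseteq> Kp" "\<And>n a. a \<in> ?E \<Longrightarrow> \<sigma> a (map b [0..<n]) \<prec> b n"
    using u by (auto simp: b_def L)
  have "\<exists>m\<in>K. \<forall>y\<in>closure_under F (range b \<union> underS lam k) \<inter> K. y \<prec> m" if k: "k \<in> K" for k
  proof -
    have "|range b \<union> underS lam k| <o \<kappa>"
      using k by (intro small_Un small_range_nat) (simp add: K_eq)
    moreover have "range b \<union> underS lam k \<subseteq> Field lam" using b(1) Kp_subset_Field lt_Field by blast
    ultimately have "|closure_under F (range b \<union> underS lam k)| <o \<kappa>" by (intro F)
    then have "|closure_under F (range b \<union> underS lam k) \<inter> K| <o \<kappa>" by (rule small_mono[rotated]) blast
    then show ?thesis by (intro bounded_in_K) blast
  qed
  then obtain f where f: "\<And>k. k \<in> K \<Longrightarrow> f k \<in> K"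
    "\<And>k y. k \<in> K \<Longrightarrow> y \<in> closure_under F (range b \<union> underS lam k) \<inter> K \<Longrightarrow> y \<prec> f k" by metis
  obtain a where a: "a \<in> K" "uncountable_cofinality a" "underS lam a \<noteq> {}"
    and step: "\<And>k. k \<prec> a \<Longrightarrow> \<exists>k'\<in>underS lam a. k \<prec> k' \<and> f k' \<prec> a"
    using ex_uncountable_cofinality_closed[OF nu, of f] f(1) by metis
  \<comment> \<open>Finitely many generators at \<open>a\<close> are already available at some
    \<open>k\<close> with \<open>f k \<prec> a\<close>; by finite support this bounds the closure at
    \<open>a\<close>.\<close>
  have fin: "\<exists>k\<in>underS lam a. f k \<prec> a \<and> Y \<subseteq> range b \<union> underS lam k"
    if "finite Y" "Y \<subseteq> range b \<union> underS lam a" for Y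
    using that
  proof (induction Y)
    case empty
    then show ?case using a(3) step by blast
  next
    case (insert y Y)
    then obtain k where k: "k \<prec> a" "f k \<prec> a" "Y \<subseteq> range b \<union> underS lam k" by auto
    show ?case
    proof (cases "y \<in> range b \<or> y \<prec> k")
      case True
      then show ?thesis using k by blast
    next
      case False
      then have ya: "y \<prec> a" using insert by blast
      then have "y = k \<or> k \<prec> y" using False lt_linear[of y k] lt_Field k(1) by blast
      moreover obtain k' where k': "k' \<prec> a" "y \<prec> k'" "f k' \<prec> a" using step[OF ya] by blast
      ultimately have "underS lam k \<subseteq> underS lam k'" using underS_subset lt_trans by blast
      then show ?thesis using k k' by blast
    qed
  qed
  have "closure_under F (range b \<union> underS lam a) \<inter> K \<subseteq> underS lam a"
  proof
    fix y assume y: "y \<in> closure_under F (range b \<union> underS lam a) \<inter> K"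
    then obtain Y where Y: "finite Y" "Y \<subseteq> range b \<union> underS lam a" "y \<in> closure_under F Y"
      using closure_under_finite_support[of y F "range b \<union> underS lam a"] by blast
    obtain k where k: "k \<prec> a" "f k \<prec> a" "Y \<subseteq> range b \<union> underS lam k" using fin[OF Y(1,2)] by blast
    have "y \<in> closure_under F (range b \<union> underS lam k)" using closure_under_mono[OF k(3)] Y(3) by blast
    then have "y \<prec> f k" using f(2) y K_down[OF a(1) k(1)] by blast
    then show "y \<prec> a" using k(2) lt_trans by blast
  qed
  moreover have "a \<in> ?E" using a(1,2) by blast
  ultimately show False using winning_strategyD(2)[OF \<sigma> b(1)] b(2) by auto
qed

section \<open>Interleaving \<kappa> many plays with a common supremum\<close>

lemma nonreflecting_stationary:
  fixes \<nu> :: "'n rel"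
  assumes nu: "regular_uncountable \<nu>" "\<nu> <o \<kappa>"
  shows "stationary_in_P \<kappa> (Field lam) nonreflecting"
  unfolding stationary_in_P_def
proof (intro allI impI)
  fix C assume C: "club_in_P \<kappa> (Field lam) C"
  obtain F where clC: "\<And>Z. Z \<subseteq> Field lam \<Longrightarrow> |Z| <o \<kappa> \<Longrightarrow> closure_under F Z \<in> C"
    and emb_closed: "\<And>Z. emb_closed (closure_under F Z)"
    using ex_closure_in_club[OF C] by blast
  let ?cl = "closure_under F"
  have C_sub: "C \<subseteq> P_less \<kappa> (Field lam)"
    using C unfolding club_in_P_def unbounded_in_P_def by blast
  have cl_small: "|?cl Z| <o \<kappa>" if "Z \<subseteq> Field lam" "|Z| <o \<kappa>" for Z
    using clC[OF that] C_sub unfolding P_less_def by blast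
  obtain a where a: "a \<in> K" "uncountable_cofinality a" "\<not> wins F a []"
    using ex_not_wins[OF nu, of F] cl_small by blast
  have a_small: "|underS lam a| <o \<kappa>" using a(1) by (simp add: K_eq)
  \<comment> \<open>Positions from which the first player cannot force a win; \<open>nxt\<close>
    moves beyond any given bound without leaving \<open>T\<close>.\<close>
  define T where "T = {s. set s \<subseteq> Kp \<and> \<not> wins F a s}"
  have "\<exists>\<beta>\<in>Kp. \<alpha> \<prec> \<beta> \<and> s @ [\<beta>] \<in> T" if "s \<in> T" "\<alpha> \<in> Kp" for s \<alpha>
    using not_wins_extend[of F a s \<alpha>] that unfolding T_def by auto
  then obtain nxt where nxt: "\<And>s \<alpha>. s \<in> T \<Longrightarrow> \<alpha> \<in> Kp \<Longrightarrow> nxt s \<alpha> \<in> Kp \<and> \<alpha> \<prec> nxt s \<alpha> \<and> s @ [nxt s \<alpha>] \<in> T"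
    by metis
  \<comment> \<open>Safe first moves. They are unbounded in \<open>Kp\<close>, hence more than
    \<kappa> many; \<kappa> of them will index the plays.\<close>
  define B where "B = {\<beta> \<in> Kp. [\<beta>] \<in> T}"
  have "\<not> |B| \<le>o \<kappa>"
  proof
    assume "|B| \<le>o \<kappa>"
    then obtain k where k: "k \<in> Kp" "\<forall>z\<in>B. z \<prec> k" using bounded_in_Kp[of B] B_def by blast
    have "[] \<in> T" using a(3) by (simp add: T_def)
    then have "nxt [] k \<in> B" "k \<prec> nxt [] k" using nxt[OF _ k(1), of "[]"] by (auto simp: B_def)
    then show False using k(2) lt_trans lt_irrefl by blast
  qed
  then have "\<kappa> \<le>o |B|"
    using not_ordLeq_iff_ordLess[OF card_of_Well_order card_order_on_well_order_on[OF Card_order_kappa]]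
      ordLess_imp_ordLeq by metis
  then have "|K| \<le>o |B|" using K_le by (rule ordLeq_transitive[rotated])
  then obtain g where g: "inj_on g K" "g ` K \<subseteq> B" using card_of_ordLeq by metis
  define B' where "B' = g ` K"
  have B'_le: "|B'| \<le>o \<kappa>" unfolding B'_def using ordLeq_transitive[OF card_of_image K_le] .
  have B'_not: "\<not> |B'| <o \<kappa>"
  proof
    assume "|B'| <o \<kappa>"
    moreover have "|K| \<le>o |B'|" using g(1) B'_def card_of_ordLeq by blast
    ultimately show False using not_K_less ordLeq_ordLess_trans by blast
  qed
  let ?c = "\<lambda>s. ?cl (set s \<union> underS lam a)"
  have c_small: "|?c s| <o \<kappa>" if "s \<in> T" for s
    using that Kp_subset_Field lt_Field
    by (intro cl_small small_Un[OF small_finite a_small]) (auto simp: T_def)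
  \<comment> \<open>The next bound takes all plays into account: \<kappa> many small closures are
    bounded together in \<open>Kp\<close>.\<close>
  have "\<exists>m. m \<in> Kp \<and> (\<forall>i\<in>B'. \<forall>y\<in>?c (st i) \<inter> Kp. y \<prec> m)" if st: "\<forall>i\<in>B'. st i \<in> T" for st
  proof -
    let ?Z = "\<Union>i\<in>B'. ?c (st i) \<inter> Kp"
    have "|?c (st i) \<inter> Kp| \<le>o \<kappa>" if "i \<in> B'" for i
      using ordLess_imp_ordLeq[OF small_mono[OF Int_lower1 c_small]] st that by blast
    then have "|?Z| \<le>o \<kappa>" using B'_le by (intro UN_le)
    moreover have "?Z \<subseteq> Kp" by blast
    ultimately show ?thesis using bounded_in_Kp[of ?Z] by auto
  qed
  then obtain M where M: "\<And>st. \<forall>i\<in>B'. st i \<in> T \<Longrightarrow> M st \<in> Kp"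
    "\<And>st i y. \<forall>i\<in>B'. st i \<in> T \<Longrightarrow> i \<in> B' \<Longrightarrow> y \<in> ?c (st i) \<inter> Kp \<Longrightarrow> y \<prec> M st"
    by metis
  \<comment> \<open>The recursion runs over whole families, since \<open>M\<close> needs all plays
    at once; \<open>st n i\<close> has length \<open>n + 1\<close>.\<close>
  define st where "st n = rec_nat (\<lambda>i. [i]) (\<lambda>_ st i. st i @ [nxt (st i) (M st)]) n" for n
  have st0: "st 0 i = [i]" and stS: "st (Suc n) i = st n i @ [nxt (st n i) (M (st n))]" for n i
    by (simp_all add: st_def)
  have stT: "\<forall>i\<in>B'. st n i \<in> T" for n
  proof (induction n)
    case 0
    then show ?case using g(2) unfolding B'_def st0 B_def by blast
  next
    case (Suc n)
    then show ?case using nxt M(1) unfolding stS by blast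
  qed
  define m where "m n = M (st n)" for n
  have m: "m n \<in> Kp" for n using M(1) stT by (simp add: m_def)
  \<comment> \<open>The common supremum of all plays: \<open>m n\<close> exceeds every closure at
    stage \<open>n\<close> and is exceeded by the move each play adds at stage
    \<open>n + 1\<close>.\<close>
  define D where "D = (\<Union>n. underS lam (m n))"
  define x where "x i = (\<Union>n. ?c (st n i))" for i
  define b where "b i n = nxt (st n i) (m n)" for i n
  have below: "y \<prec> m n" if "i \<in> B'" "y \<in> ?c (st n i) \<inter> Kp" for i n y
    using M(2)[OF stT that] by (simp add: m_def)
  have b: "b i n \<in> Kp" "m n \<prec> b i n" "b i n \<in> ?c (st (Suc n) i)" if "i \<in> B'" for i n
    using nxt[of "st n i" "m n"] stT that m unfolding b_def
    by (auto simp: stS m_def intro!: closure_under.base)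
  have D_le: "|D| \<le>o \<kappa>"
    unfolding D_def using m ordLess_imp_ordLeq[OF small_nat] by (intro UN_le) (auto simp: Kp_def)
  have st_mono: "set (st n i) \<subseteq> set (st k i)" if "n \<le> k" for n k i
    using that by (rule lift_Suc_mono_le[of "\<lambda>n. set (st n i)", rotated]) (auto simp: stS)
  define Z where "Z i = (\<Union>n. set (st n i)) \<union> underS lam a" for i
  \<comment> \<open>By finite support the increasing union of closures is itself a closure, so it
    belongs to \<open>C\<close>.\<close>
  have x_cl: "x i = ?cl (Z i)" for i
  proof (intro set_eqI iffI)
    fix y assume "y \<in> x i"
    then obtain n where "y \<in> ?c (st n i)" by (auto simp: x_def)
    moreover have "?c (st n i) \<subseteq> ?cl (Z i)" by (rule closure_under_mono) (auto simp: Z_def)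
    ultimately show "y \<in> ?cl (Z i)" by blast
  next
    fix y assume "y \<in> ?cl (Z i)"
    then obtain Y where Y: "finite Y" "Y \<subseteq> Z i" "y \<in> ?cl Y" using closure_under_finite_support[of y F "Z i"] by blast
    have "\<exists>n. Y \<subseteq> set (st n i) \<union> underS lam a" using Y(1,2)
    proof (induction Y)
      case (insert z Y)
      then obtain n where n: "Y \<subseteq> set (st n i) \<union> underS lam a" by auto
      obtain k where k: "z \<in> set (st k i) \<union> underS lam a" using insert by (auto simp: Z_def)
      have "insert z Y \<subseteq> set (st (max n k) i) \<union> underS lam a"
        using n k st_mono[of n "max n k" i] st_mono[of k "max n k" i] by auto
      then show ?case by blast
    qed auto
    then obtain n where n: "Y \<subseteq> set (st n i) \<union> underS lam a" by blast
    then show "y \<in> x i" using closure_under_mono[OF n, of F] Y(3) unfolding x_def by blast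
  qed
  have x_C: "x i \<in> C" if "i \<in> B'" for i unfolding x_cl
  proof (rule clC)
    have "set (st n i) \<subseteq> Kp" for n using stT that by (auto simp: T_def)
    then show "Z i \<subseteq> Field lam" unfolding Z_def using Kp_subset_Field lt_Field by blast
    show "|Z i| <o \<kappa>" unfolding Z_def
      by (intro small_Un a_small small_UN small_nat small_finite finite_set)
  qed
  have x_K: "x i \<inter> K = underS lam a" if "i \<in> B'" for i
  proof
    have "?c (st n i) \<inter> K \<subseteq> underS lam a" for n
      using not_wins_closure[of F a "st n i"] stT that by (auto simp: T_def)
    then show "x i \<inter> K \<subseteq> underS lam a" unfolding x_def by blast
    show "underS lam a \<subseteq> x i \<inter> K"
      using K_down[OF a(1)] unfolding x_cl Z_def by (auto intro: closure_under.base)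
  qed
  have x_Kp: "\<exists>n. y \<prec> m n" if "i \<in> B'" "y \<in> x i \<inter> Kp" for i y
    using below[OF that(1)] that(2) unfolding x_def by blast
  have b_x: "b i n \<in> x i \<inter> Kp" if "i \<in> B'" for i n using b[OF that] unfolding x_def by blast
  have down_x: "down (x i) = D" if i: "i \<in> B'" for i
  proof (intro set_eqI iffI)
    fix y assume "y \<in> down (x i)"
    then obtain z where z: "z \<in> x i \<inter> Kp" "(y, z) \<in> lam" unfolding down_def by blast
    then obtain n where n: "z \<prec> m n" using x_Kp i by blast
    then have "y \<prec> m n" using z(2) lt_trans[of y z] by (cases "y = z") (auto simp: underS_def)
    then show "y \<in> D" unfolding D_def by blast
  next
    fix y assume "y \<in> D"
    then obtain n where n: "y \<prec> m n" unfolding D_def by blast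
    then have "y \<prec> b i n" using b(2)[OF i] lt_trans by blast
    then have "(y, b i n) \<in> lam" by (simp add: underS_def)
    moreover have "y \<in> Kp" using n m Kp_down by blast
    ultimately show "y \<in> down (x i)" using b_x[OF i] unfolding down_def by blast
  qed
  \<comment> \<open>Each first move \<open>i\<close> lies in \<open>x i\<close>, so equality for all
    \<open>i\<close> would place the \<kappa> many elements of \<open>B'\<close> in one set of size
    below \<kappa>.\<close>
  have "\<exists>i\<in>B'. x i \<inter> Kp \<noteq> {d \<in> D. emb D d \<prec> a}"
  proof (rule ccontr)
    assume "\<not> ?thesis"
    then have eq: "x i \<inter> Kp = {d \<in> D. emb D d \<prec> a}" if "i \<in> B'" for i using that by blast
    let ?Q = "{d \<in> D. emb D d \<prec> a}"
    have "inj_on (emb D) ?Q" using emb(1)[OF D_le] by (rule inj_on_subset) auto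
    then have "|?Q| \<le>o |underS lam a|" by (intro card_of_ordLeqI) auto
    then have Q: "|?Q| <o \<kappa>" using a_small by (rule ordLeq_ordLess_trans)
    have "i \<in> ?Q" if i: "i \<in> B'" for i
    proof -
      have "i \<in> ?c (st 0 i)" by (auto simp: st0 intro: closure_under.base)
      then have "i \<in> x i" unfolding x_def by blast
      moreover have "i \<in> Kp" using i g(2) unfolding B'_def B_def by blast
      ultimately show ?thesis using eq[OF i] by blast
    qed
    then have "B' \<subseteq> ?Q" by blast
    then show False using small_mono[OF _ Q] B'_not by blast
  qed
  then obtain i where i: "i \<in> B'" "x i \<inter> Kp \<noteq> {d \<in> D. emb D d \<prec> a}" by blast
  have "x i \<in> nonreflecting"
    unfolding nonreflecting_def
  proof (intro CollectI conjI)
    show "x i \<in> P_less \<kappa> (Field lam)" using x_C[OF i(1)] C_sub by blast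
    show "emb_closed (x i)" unfolding x_cl by (rule emb_closed)
    have "\<exists>n. y \<prec> b i n" if "y \<in> x i \<inter> Kp" for y
      using x_Kp[OF i(1) that] b(2)[OF i(1)] lt_trans by blast
    then show "\<exists>c. range c \<subseteq> x i \<inter> Kp \<and> (\<forall>y\<in>x i \<inter> Kp. \<exists>n. y \<prec> c (n::nat))"
      using b_x[OF i(1)] by (intro exI[of _ "b i"]) blast
    show "\<exists>a\<in>K. uncountable_cofinality a \<and> x i \<inter> K = underS lam a \<and>
        x i \<inter> Kp \<noteq> {d \<in> down (x i). emb (down (x i)) d \<prec> a}"
      using a x_K[OF i(1)] i(2) down_x[OF i(1)] by (intro bexI[of _ a]) auto
  qed
  then show "nonreflecting \<inter> C \<noteq> {}" using x_C[OF i(1)] by blast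
qed

end

theorem theorem2:
  fixes \<nu> :: "'n rel" and \<kappa> :: "'k rel" and lam :: "'l rel"
  assumes "regular_uncountable \<nu>" and "regular_uncountable \<kappa>" and "\<nu> <o \<kappa>"
    and "\<And>\<gamma> :: 'k rel. Well_order \<gamma> \<Longrightarrow> \<nu> <o \<gamma> \<Longrightarrow> \<gamma> <o \<kappa> \<Longrightarrow> cf_P \<nu> \<gamma> <o \<kappa>"
    and "Card_order lam" and "cardSuc \<kappa> \<le>o lam"
  shows "\<not> stationary_reflection \<kappa> lam \<and>
    (\<exists>S. S \<subseteq> P_less \<kappa> (Field lam) \<and> stationary_in_P \<kappa> (Field lam) S \<and>
      (\<forall>A. ordinals_below \<kappa> lam \<subseteq> A \<and> A \<subseteq> Field lam \<and> |A| =o \<kappa> \<longrightarrow>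
         \<not> stationary_in_P \<kappa> A (S \<inter> P_less \<kappa> A)))"
proof -
  have "Card_order \<kappa>" using assms(2) by (simp add: regular_uncountable_def)
  then have "\<kappa> <o lam" using cardSuc_ordLess_ordLeq assms(5,6) by blast
  then interpret below_successor \<kappa> lam
    using assms by unfold_locales
  have sub: "nonreflecting \<subseteq> P_less \<kappa> (Field lam)" by (auto simp: nonreflecting_def)
  have stat: "stationary_in_P \<kappa> (Field lam) nonreflecting"
    using nonreflecting_stationary assms(1,3) .
  have nonrefl: "\<forall>A. ordinals_below \<kappa> lam \<subseteq> A \<and> A \<subseteq> Field lam \<and> |A| =o \<kappa> \<longrightarrow>
      \<not> stationary_in_P \<kappa> A (nonreflecting \<inter> P_less \<kappa> A)"
    using nonreflecting_not_stationary ordIso_imp_ordLeq by blast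
  have "\<not> stationary_reflection \<kappa> lam"
  proof
    assume "stationary_reflection \<kappa> lam"
    from this[unfolded stationary_reflection_def, rule_format, OF conjI[OF sub stat]] nonrefl
    show False by blast
  qed
  then show ?thesis
    using sub stat nonrefl by (intro conjI exI[of _ nonreflecting])
qed

end
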